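(* Assume that conditions (C1), (C2), (C3) and (C4) stated in the context hold. Let $\Theta\subset\operatorname{dom}(\Lambda)$ be finite and nonempty, and let $\mathcal{C}_*=\{j\in[J]:r_j=r_*\}$. If $\beta^j\notin\Theta$ for some $j\in\mathcal{C}_*$, then $\mathbb{P}_\Theta$ fails to be asymptotically efficient for estimating $\mathbb{P}(\tau_b^*<\tau_b^0)$, i.e., $$\liminf_{b\to\infty}\frac1b\log\mathbb{E}_\Theta\left[\left(\widehat{\mathbb{W}}_b(\Theta)\right)^2\right]>-2r_*.$$
   Context: $X_1,X_2,\ldots$ are i.i.d. $\mathbb{R}^d$-valued random vectors on a probability space $(\Omega,\mathcal{F},\mathbb{P})$, $S_0=0$, $S_n=\sum_{i=1}^nX_i$, $\mathcal{F}_n=\sigma(X_1,\ldots,X_n)$ ($\mathcal{F}_0$ trivial). For $\theta,x\in\mathbb{R}^d$: $\Lambda(\theta)=\log\mathbb{E}[e^{\theta\cdot X_1}]\in(-\infty,\infty]$, $\Lambda^*(x)=\sup_{\theta\in\mathbb{R}^d}\{\theta\cdot x-\Lambda(\theta)\}$, $I(x)=\sup\{\theta\cdot x:\Lambda(\theta)\le 0\}$. For a function $f$, $\operatorname{dom}(f)=\{f<\infty\}$; $\operatorname{cone}(A)=\{\lambda x:\lambda>0,x\in A\}$; $B(x,r)$ is the open Euclidean ball; $[J]=\{1,\ldots,J\}$. $W^1,\ldots,W^J\subset\mathbb{R}^d$ are open convex sets and $W^0\subset\mathbb{R}^d$ is an open set. For $b>0$, $\tau_b^j=\inf\{n\ge0:S_n\in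 bW^j\}$ for $j=0,1,\ldots,J$ (with $\inf\emptyset=\infty$), $\tau_b^*=\min_{j\in[J]}\tau_b^j$. For $j\in[J]$, $r_j=\inf_{x\in W^j}I(x)$; $r_*=\min_{j\in[J]}r_j$. (C1) There is $\delta>0$ such that $\operatorname{cone}(B(\mathbb{E}[X_1],\delta))\cap W^j=\emptyset$ for every $j\in[J]$. (C2) $\operatorname{dom}(\Lambda)$ is open, and $\operatorname{int}(\operatorname{cone}(\operatorname{dom}(\Lambda^* )))\cap W^j\neq\emptyset$ for every $j\in[J]$. (C3) $\operatorname{cone}(W^j)\cap\operatorname{cone}(W^{j'})=\emptyset$ for all $0\le j\ne j'\le J$, and there is $\delta>0$ such that $B(\mathbf 0,\delta)\cap W^j=\emptyset$ for each $j\in\{0\}\cup[J]$. (C4) $\overline{\operatorname{cone}(W^j)}\cap\overline{\operatorname{cone}(W^{j'})}=\{\mathbf 0\}$ for $0\le j\ne j'\le J$; and either $W^0=\emptyset$, or $W^0$ is convex and $\operatorname{int}(\operatorname{cone}(\operatorname{dom}(\Lambda^* )))\cap W^0\ne\emptyset$. (When $W^0=\emptyset$ the cone condition is understood for the nonempty sets $W^j$, $j\in[J]$.) Under (C1)–(C2), for each $j\in[J]$ there is a unique $\beta^j\in\mathbb{R}^d$ (the optimal tilting associated with $W^j$) with $\Lambda(\beta^j)=0$, $W^j\subset\{v:\beta^j\cdot v\ge r_j\}$ and $\{x:I(x)\le r_j\}\subset\{v:\beta^j\cdot v\le r_j\}$ (known result of Collamore). For $\theta\in\operatorname{dom}(\Lambda)$,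 $\mathbb{P}_\theta$ is the probability measure with $\frac{d\mathbb{P}_\theta}{d\mathbb{P}}(\mathcal{F}_n)=\exp(\theta\cdot S_n-n\Lambda(\theta))$ for all $n$. $\mathbb{P}_\Theta=\frac1{|\Theta|}\sum_{\theta\in\Theta}\mathbb{P}_\theta$ with expectation $\mathbb{E}_\Theta$. For a stopping time $T$, $\mathbb{L}_\theta(T)=\exp(\theta\cdot S_T-T\Lambda(\theta))\mathbf 1\{T<\infty\}$, and $$\widehat{\mathbb{W}}_b(\Theta)=\Big(\frac1{|\Theta|}\sum_{\theta\in\Theta}\mathbb{L}_\theta(\tau_b^* )\Big)^{-1}\mathbf 1\{\tau_b^*<\tau_b^0\}$$ (equal to $0$ off the event $\{\tau_b^*<\tau_b^0\}$). $\mathbb{P}_\Theta$ is called asymptotically efficient for estimating $\mathbb{P}(\tau_b^*<\tau_b^0)$ if $\log\mathbb{E}_\Theta[(\widehat{\mathbb{W}}_b(\Theta))^2]\big/\big(2\log\mathbb{P}(\tau_b^*<\tau_b^0)\big)\to1$ as $b\to\infty$.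
   Formalization: Added assumption: for each j in C_*, no θ in Θ other than β^j has (θ−β^j)·X_1 almost surely constant; such a θ gives P_θ=P_{β^j}, and the claim as written can then fail (e.g. X_1=(1,Y) with Y standard normal). *)

theory Defs
  imports "HOL-Probability.Probability"
begin

section \<open>Extended logarithm, cones and scaling\<close>

definition elog :: "ennreal \<Rightarrow> ereal" where
  "elog x = (if x = 0 then -\<infinity> else if x = \<infinity> then \<infinity> else ereal (ln (enn2real x)))"

text \<open>The apex is not added: the scalars are strictly positive, unlike in \<open>cone hull\<close>.\<close>

definition pos_cone :: "'v::real_vector set \<Rightarrow> 'v set" where
  "pos_cone A = {c *\<^sub>R x | c x. c > 0 \<and> x \<in> A}"

definition edom :: "('v \<Rightarrow> ereal) \<Rightarrow> 'v set" where
  "edom f = {x. f x < \<infinity>}"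


section \<open>The random walk\<close>

text \<open>The increments are \<open>X 1, X 2, \<dots>\<close>; the value \<open>X 0\<close> is never used.\<close>

definition iid_vectors :: "'a measure \<Rightarrow> (nat \<Rightarrow> 'a \<Rightarrow> real^'d) \<Rightarrow> bool" where
  "iid_vectors M X \<longleftrightarrow>
     prob_space.indep_vars M (\<lambda>_. borel) X {1..} \<and>
     (\<forall>i\<ge>1. distr M borel (X i) = distr M borel (X 1))"

definition walk :: "(nat \<Rightarrow> 'a \<Rightarrow> real^'d) \<Rightarrow> nat \<Rightarrow> 'a \<Rightarrow> real^'d" where
  "walk X n \<omega> = (\<Sum>i=1..n. X i \<omega>)"

definition natural_filtration ::
    "'a measure \<Rightarrow> (nat \<Rightarrow> 'a \<Rightarrow> real^'d) \<Rightarrow> nat \<Rightarrow> 'a measure" where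
  "natural_filtration M X n =
     sigma (space M) (\<Union>i\<in>{1..n}. {X i -` A \<inter> space M | A. A \<in> sets borel})"


section \<open>Large-deviation functions\<close>

definition cgf :: "'a measure \<Rightarrow> (nat \<Rightarrow> 'a \<Rightarrow> real^'d) \<Rightarrow> real^'d \<Rightarrow> ereal" where
  "cgf M X \<theta> = elog (\<integral>\<^sup>+\<omega>. ennreal (exp (\<theta> \<bullet> X 1 \<omega>)) \<partial>M)"

definition rate :: "'a measure \<Rightarrow> (nat \<Rightarrow> 'a \<Rightarrow> real^'d) \<Rightarrow> real^'d \<Rightarrow> ereal" where
  "rate M X x = (SUP \<theta>. ereal (\<theta> \<bullet> x) - cgf M X \<theta>)"

definition support_rate :: "'a measure \<Rightarrow> (nat \<Rightarrow> 'a \<Rightarrow> real^'d) \<Rightarrow> real^'d \<Rightarrow> ereal" where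
  "support_rate M X x = (SUP \<theta>\<in>{\<theta>. cgf M X \<theta> \<le> 0}. ereal (\<theta> \<bullet> x))"

definition set_rate :: "'a measure \<Rightarrow> (nat \<Rightarrow> 'a \<Rightarrow> real^'d) \<Rightarrow> (real^'d) set \<Rightarrow> ereal" where
  "set_rate M X A = (INF x\<in>A. support_rate M X x)"

definition min_rate ::
    "'a measure \<Rightarrow> (nat \<Rightarrow> 'a \<Rightarrow> real^'d) \<Rightarrow> nat \<Rightarrow> (nat \<Rightarrow> (real^'d) set) \<Rightarrow> ereal" where
  "min_rate M X J W = (MIN j\<in>{1..J}. set_rate M X (W j))"


section \<open>Geometric conditions\<close>

text \<open>The target sets are \<open>W 1, \<dots>, W J\<close>; \<open>W 0\<close> is the set that must be avoided.\<close>

definition cond_C1 ::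
    "'a measure \<Rightarrow> (nat \<Rightarrow> 'a \<Rightarrow> real^'d) \<Rightarrow> nat \<Rightarrow> (nat \<Rightarrow> (real^'d) set) \<Rightarrow> bool" where
  "cond_C1 M X J W \<longleftrightarrow>
     (\<exists>\<delta>>0. \<forall>j\<in>{1..J}. pos_cone (ball (\<integral>\<omega>. X 1 \<omega> \<partial>M) \<delta>) \<inter> W j = {})"

definition cond_C2 ::
    "'a measure \<Rightarrow> (nat \<Rightarrow> 'a \<Rightarrow> real^'d) \<Rightarrow> nat \<Rightarrow> (nat \<Rightarrow> (real^'d) set) \<Rightarrow> bool" where
  "cond_C2 M X J W \<longleftrightarrow>
     open (edom (cgf M X)) \<and>
     (\<forall>j\<in>{1..J}. interior (pos_cone (edom (rate M X))) \<inter> W j \<noteq> {})"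

definition cond_C3 :: "nat \<Rightarrow> (nat \<Rightarrow> (real^'d) set) \<Rightarrow> bool" where
  "cond_C3 J W \<longleftrightarrow>
     (\<forall>j\<in>{0..J}. \<forall>j'\<in>{0..J}. j \<noteq> j' \<longrightarrow> pos_cone (W j) \<inter> pos_cone (W j') = {}) \<and>
     (\<exists>\<delta>>0. \<forall>j\<in>{0..J}. ball 0 \<delta> \<inter> W j = {})"

text \<open>The nonemptiness guard matters only for \<open>W 0\<close>: an empty set has an empty cone, so the
  condition on the closed cones is imposed on the nonempty sets. The targets are nonempty
  by \<open>cond_C2\<close>.\<close>

definition cond_C4 ::
    "'a measure \<Rightarrow> (nat \<Rightarrow> 'a \<Rightarrow> real^'d) \<Rightarrow> nat \<Rightarrow> (nat \<Rightarrow> (real^'d) set) \<Rightarrow> bool" where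
  "cond_C4 M X J W \<longleftrightarrow>
     (\<forall>j\<in>{0..J}. \<forall>j'\<in>{0..J}. j \<noteq> j' \<longrightarrow> W j \<noteq> {} \<longrightarrow> W j' \<noteq> {} \<longrightarrow>
        closure (pos_cone (W j)) \<inter> closure (pos_cone (W j')) = {0}) \<and>
     (W 0 = {} \<or> convex (W 0) \<and> interior (pos_cone (edom (rate M X))) \<inter> W 0 \<noteq> {})"

definition is_optimal_tilting ::
    "'a measure \<Rightarrow> (nat \<Rightarrow> 'a \<Rightarrow> real^'d) \<Rightarrow> (real^'d) set \<Rightarrow> real^'d \<Rightarrow> bool" where
  "is_optimal_tilting M X A \<beta> \<longleftrightarrow>
     cgf M X \<beta> = 0 \<and>
     A \<subseteq> {v. ereal (\<beta> \<bullet> v) \<ge> set_rate M X A} \<and>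
     {x. support_rate M X x \<le> set_rate M X A} \<subseteq> {v. ereal (\<beta> \<bullet> v) \<le> set_rate M X A}"


section \<open>Hitting times\<close>

text \<open>In \<^typ>\<open>enat\<close> the infimum of the empty set is \<open>\<infinity>\<close>.\<close>

definition hit_time ::
    "(nat \<Rightarrow> 'a \<Rightarrow> real^'d) \<Rightarrow> (real^'d) set \<Rightarrow> real \<Rightarrow> 'a \<Rightarrow> enat" where
  "hit_time X A b \<omega> = (INF n\<in>{n. walk X n \<omega> \<in> (\<lambda>x. b *\<^sub>R x) ` A}. enat n)"

definition first_target_time ::
    "(nat \<Rightarrow> 'a \<Rightarrow> real^'d) \<Rightarrow> nat \<Rightarrow> (nat \<Rightarrow> (real^'d) set) \<Rightarrow> real \<Rightarrow> 'a \<Rightarrow> enat" where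
  "first_target_time X J W b \<omega> = (MIN j\<in>{1..J}. hit_time X (W j) b \<omega>)"


section \<open>Exponential tilting and the importance sampling estimator\<close>

text \<open>\<open>Q\<close> plays the role of \<open>P\<^sub>\<theta>\<close>: on each \<open>F\<^sub>n\<close> it has the stated density with respect to \<open>M\<close>.
  On all of \<open>sets M\<close> it is in general not absolutely continuous with respect to \<open>M\<close>.\<close>

definition is_tilted_measure ::
    "'a measure \<Rightarrow> (nat \<Rightarrow> 'a \<Rightarrow> real^'d) \<Rightarrow> real^'d \<Rightarrow> 'a measure \<Rightarrow> bool" where
  "is_tilted_measure M X \<theta> Q \<longleftrightarrow>
     prob_space Q \<and> sets Q = sets M \<and>
     (\<forall>n. \<forall>A\<in>sets (natural_filtration M X n).
        emeasure Q A =
          (\<integral>\<^sup>+\<omega>\<in>A. ennreal (exp (\<theta> \<bullet> walk X n \<omega> - real n * real_of_ereal (cgf M X \<theta>))) \<partial>M))"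

text \<open>If \<open>(\<theta> - \<theta>') \<bullet> X 1\<close> is almost surely a constant \<open>c\<close>, then \<open>cgf M X \<theta> = cgf M X \<theta>' + c\<close> and the
  densities defining \<open>P\<^sub>\<theta>\<close> and \<open>P\<^bsub>\<theta>'\<^esub>\<close> agree, so the two parameters index the same tilting. For
  \<open>\<theta> \<noteq> \<theta>'\<close> this happens only if the law of \<open>X 1\<close> is carried by an affine hyperplane.\<close>

definition same_tilting ::
    "'a measure \<Rightarrow> (nat \<Rightarrow> 'a \<Rightarrow> real^'d) \<Rightarrow> real^'d \<Rightarrow> real^'d \<Rightarrow> bool" where
  "same_tilting M X \<theta> \<theta>' \<longleftrightarrow> (\<exists>c. AE \<omega> in M. (\<theta> - \<theta>') \<bullet> X 1 \<omega> = c)"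

definition mixture ::
    "'a measure \<Rightarrow> (real^'d \<Rightarrow> 'a measure) \<Rightarrow> (real^'d) set \<Rightarrow> 'a measure" where
  "mixture M P \<Theta> =
     measure_of (space M) (sets M) (\<lambda>A. (\<Sum>\<theta>\<in>\<Theta>. emeasure (P \<theta>) A) / of_nat (card \<Theta>))"

definition likelihood_ratio ::
    "'a measure \<Rightarrow> (nat \<Rightarrow> 'a \<Rightarrow> real^'d) \<Rightarrow> real^'d \<Rightarrow> ('a \<Rightarrow> enat) \<Rightarrow> 'a \<Rightarrow> real" where
  "likelihood_ratio M X \<theta> T \<omega> =
     (case T \<omega> of
        enat n \<Rightarrow> exp (\<theta> \<bullet> walk X n \<omega> - real n * real_of_ereal (cgf M X \<theta>))
      | \<infinity> \<Rightarrow> 0)"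

definition sampling_estimator ::
    "'a measure \<Rightarrow> (nat \<Rightarrow> 'a \<Rightarrow> real^'d) \<Rightarrow> nat \<Rightarrow> (nat \<Rightarrow> (real^'d) set) \<Rightarrow> (real^'d) set
       \<Rightarrow> real \<Rightarrow> 'a \<Rightarrow> real" where
  "sampling_estimator M X J W \<Theta> b \<omega> =
     (if first_target_time X J W b \<omega> < hit_time X (W 0) b \<omega>
      then inverse ((1 / real (card \<Theta>)) *
             (\<Sum>\<theta>\<in>\<Theta>. likelihood_ratio M X \<theta> (first_target_time X J W b) \<omega>))
      else 0)"

definition second_moment ::
    "'a measure \<Rightarrow> (nat \<Rightarrow> 'a \<Rightarrow> real^'d) \<Rightarrow> nat \<Rightarrow> (nat \<Rightarrow> (real^'d) set)
       \<Rightarrow> (real^'d \<Rightarrow> 'a measure) \<Rightarrow> (real^'d) set \<Rightarrow> real \<Rightarrow> ennreal" where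
  "second_moment M X J W P \<Theta> b =
     (\<integral>\<^sup>+\<omega>. ennreal ((sampling_estimator M X J W \<Theta> b \<omega>)\<^sup>2) \<partial>(mixture M P \<Theta>))"

definition asymptotically_efficient ::
    "'a measure \<Rightarrow> (nat \<Rightarrow> 'a \<Rightarrow> real^'d) \<Rightarrow> nat \<Rightarrow> (nat \<Rightarrow> (real^'d) set)
       \<Rightarrow> (real^'d \<Rightarrow> 'a measure) \<Rightarrow> (real^'d) set \<Rightarrow> bool" where
  "asymptotically_efficient M X J W P \<Theta> \<longleftrightarrow>
     ((\<lambda>b::real. elog (second_moment M X J W P \<Theta> b) /
         (2 * elog (emeasure M {\<omega> \<in> space M. first_target_time X J W b \<omega> < hit_time X (W 0) b \<omega>})))
       \<longlongrightarrow> 1) at_top"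

end

theory Submission
  imports Defs "HOL-Real_Asymp.Real_Asymp"
begin

text \<open>
  Write \<open>r\<close> for the minimal rate and fix a minimising target \<open>W j\<close> whose optimal tilting
  \<open>\<beta> = \<beta> j\<close> is missing from \<open>\<Theta>\<close>. A point \<open>x\<close> of \<open>W j\<close> that nearly minimises the support function
  of \<open>{\<Lambda> \<le> 0}\<close> has, by Lagrange multipliers, the form \<open>x = c \<nabla>\<Lambda>(\<eta>)\<close> with \<open>\<Lambda>(\<eta>) = 0\<close> and \<open>c > 0\<close>.
  Under the tilting by \<open>\<eta>\<close> the walk follows the segment from \<open>0\<close> to \<open>b x\<close> up to \<open>o(b)\<close>, hence it reaches
  a target within about \<open>c b\<close> steps, before \<open>b W\<^sub>0\<close>. This event contributes to the second moment at least
  \<open>exp (- b (\<eta> \<bullet> x + g) - o(b))\<close>, where \<open>g\<close> is the positive part of the maximum of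
  \<open>\<theta> \<bullet> x - c \<Lambda>(\<theta>)\<close> over \<open>\<theta>\<close> in \<open>\<Theta>\<close>. Now \<open>\<eta> \<bullet> x\<close> is close to \<open>r\<close>, while strict convexity of \<open>\<Lambda>\<close>
  between \<open>\<theta>\<close> and \<open>\<beta>\<close> keeps \<open>g\<close> away from \<open>r\<close>, so that the exponent beats \<open>- 2 r b\<close>. As the
  hitting probability is at most \<open>J exp (- r b)\<close>, the log ratio stays below \<open>1\<close>.
\<close>

section \<open>Exponential tiltings of a random vector\<close>

text \<open>Since \<open>W j\<close> is open, its rate need not be attained in it, and at an
  arbitrary near-optimal point the maximum over {\<Lambda> \<le> 0} need not be attained either. So
  the point is moved slightly towards an interior point of the cone over the domain of the conjugate
  of \<Lambda>, supplied by \<open>cond_C2\<close>; this makes the relevant part of {\<Lambda> \<le>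
  0} compact. The resulting \<eta> depends on the chosen accuracy, and the convexity gap between
  \<theta> and \<beta> enters multiplied by c. The gain would be lost if c tended to 0 as the
  accuracy improves, so a lower bound for c is fixed beforehand; it comes from the openness of the
  domain of \<Lambda>. If the law of \<open>X 1\<close> is carried by a hyperplane, \<Lambda> is
  affine in some direction and distinct parameters can give the same tilting; the hypothesis on
  \<open>same_tilting\<close> prevents an element of \<Theta> from replacing \<beta> in this way.
  The positive part g appears because the walk may meet a target well before c b steps, and the
  estimate has to cover every such time.\<close>

lemma exp_le_quadratic:
  fixes s t z :: real
  assumes "0 < t" "t \<le> s / 2"
  shows "exp (t * z) \<le> 1 + t * z + t\<^sup>2 * (4 / s\<^sup>2 * (exp (s * z) + exp (- s * z)))"
proof -
  have s: "s > 0" using assms by simp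
  obtain \<xi> where \<xi>: "\<bar>\<xi>\<bar> \<le> \<bar>t * z\<bar>"
    and eq: "exp (t * z) = (\<Sum>m<2. (t * z) ^ m / fact m) + exp \<xi> / fact 2 * (t * z) ^ 2"
    using Maclaurin_exp_le[of "t * z" 2] by blast
  \<comment> \<open>Of the exponent \<open>s\<close>, one half pays for \<open>exp \<xi>\<close> and
    the other for \<open>z\<^sup>2\<close>; hence the restriction
    \<open>t \<le> s / 2\<close>.\<close>
  have "\<xi> \<le> s / 2 * \<bar>z\<bar>"
    using \<xi> assms mult_right_mono[of t "s/2" "\<bar>z\<bar>"] by (auto simp: abs_mult)
  then have e1: "exp \<xi> \<le> exp (s / 2 * \<bar>z\<bar>)" by simp
  have "(s / 2 * \<bar>z\<bar>)\<^sup>2 / 2 \<le> exp (s / 2 * \<bar>z\<bar>)"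
    using exp_lower_Taylor_quadratic[of "s / 2 * \<bar>z\<bar>"] s
      mult_nonneg_nonneg[of "s / 2" "\<bar>z\<bar>"] by linarith
  then have e2: "z\<^sup>2 / 2 \<le> 4 / s\<^sup>2 * exp (s / 2 * \<bar>z\<bar>)"
    using s by (simp add: power2_eq_square field_simps)
  have "exp \<xi> / fact 2 * (t * z) ^ 2 = t\<^sup>2 * (exp \<xi> * (z\<^sup>2 / 2))"
    by (simp add: power_mult_distrib)
  also have "\<dots> \<le> t\<^sup>2 * (exp (s / 2 * \<bar>z\<bar>) * (4 / s\<^sup>2 * exp (s / 2 * \<bar>z\<bar>)))"
    using e1 e2 by (intro mult_left_mono mult_mono) auto
  also have "exp (s / 2 * \<bar>z\<bar>) * (4 / s\<^sup>2 * exp (s / 2 * \<bar>z\<bar>)) = 4 / s\<^sup>2 * exp (s * \<bar>z\<bar>)"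
    by (simp flip: exp_add add: field_simps)
  also have "exp (s * \<bar>z\<bar>) \<le> exp (s * z) + exp (- s * z)"
    by (cases "z \<ge> 0") auto
  finally have "exp \<xi> / fact 2 * (t * z) ^ 2 \<le> t\<^sup>2 * (4 / s\<^sup>2 * (exp (s * z) + exp (- s * z)))"
    by (simp add: mult_left_mono divide_right_mono)
  moreover have "(\<Sum>m<2. (t * z) ^ m / fact m) = 1 + t * z"
    by (simp add: numeral_2_eq_2)
  ultimately show ?thesis using eq by linarith
qed

text \<open>Farkas' lemma for one strict constraint, because only directions of strict decrease of
  \<open>mgf\<close> are known to lead into the sublevel set. The part \<open>w\<close> of
  \<open>x\<close> orthogonal to \<open>u\<close> is not admissible itself, but
  \<open>w - \<epsilon> *\<^sub>R u\<close> is, and letting \<epsilon> tend to 0 gives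
  \<open>w \<bullet> w = w \<bullet> x \<le> 0\<close>.\<close>

lemma farkas_single:
  fixes u x :: "'v::real_inner"
  assumes "u \<noteq> 0" "x \<noteq> 0" and *: "\<And>h. h \<bullet> u < 0 \<Longrightarrow> h \<bullet> x \<le> 0"
  obtains c where "c > 0" "x = c *\<^sub>R u"
proof -
  define c where "c = (x \<bullet> u) / (u \<bullet> u)"
  define w where "w = x - c *\<^sub>R u"
  have uu: "u \<bullet> u > 0" using assms by simp
  have wu: "w \<bullet> u = 0" using uu by (simp add: w_def c_def inner_diff_left)
  have *: "w \<bullet> x \<le> \<epsilon> * (u \<bullet> x)" if "\<epsilon> > 0" for \<epsilon>
    using *[of "w - \<epsilon> *\<^sub>R u"] that uu wu by (simp add: inner_diff_left)
  have "w \<bullet> x \<le> 0"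
  proof (rule field_le_epsilon)
    fix e :: real assume "e > 0"
    then have "w \<bullet> x \<le> e / (\<bar>u \<bullet> x\<bar> + 1) * (u \<bullet> x)" by (intro *) auto
    also have "\<dots> \<le> e / (\<bar>u \<bullet> x\<bar> + 1) * (\<bar>u \<bullet> x\<bar> + 1)"
      using \<open>e > 0\<close> by (intro mult_left_mono) auto
    also have "\<dots> = e" by simp
    finally show "w \<bullet> x \<le> 0 + e" by simp
  qed
  moreover have "w \<bullet> x = w \<bullet> w"
    using wu by (simp add: w_def inner_diff_right inner_commute)
  ultimately have "\<not> 0 < w \<bullet> w" by linarith
  then have "w = 0" unfolding inner_gt_zero_iff by simp
  then have x: "x = c *\<^sub>R u" by (simp add: w_def)
  have "0 \<le> u \<bullet> x" using assms(3)[of "- u"] uu by simp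
  then have "c \<ge> 0" unfolding c_def using uu by (simp add: inner_commute)
  then have "c > 0" using x \<open>x \<noteq> 0\<close> by (cases "c = 0") auto
  then show ?thesis using that x by blast
qed

section \<open>Moment generating function and its sublevel set\<close>

locale random_vector = prob_space M for M :: "'a measure" +
  fixes Y :: "'a \<Rightarrow> 'v::euclidean_space"
  assumes Y [measurable]: "Y \<in> borel_measurable M"
begin

definition mgf_dom :: "'v set" where
  "mgf_dom = {\<theta>. integrable M (\<lambda>\<omega>. exp (\<theta> \<bullet> Y \<omega>))}"

definition mgf :: "'v \<Rightarrow> real" where
  "mgf \<theta> = expectation (\<lambda>\<omega>. exp (\<theta> \<bullet> Y \<omega>))"

text \<open>Not normalised: this is the mean of \<open>Y\<close> under the tilting by \<open>\<eta>\<close> only when \<open>mgf \<eta> = 1\<close>.\<close>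

definition tilted_mean :: "'v \<Rightarrow> 'v" where
  "tilted_mean \<eta> = expectation (\<lambda>\<omega>. exp (\<eta> \<bullet> Y \<omega>) *\<^sub>R Y \<omega>)"

text \<open>The set {\<Lambda> \<le> 0}, whose support function is
  \<open>support_rate\<close>.\<close>

definition mgf_sublevel :: "'v set" where
  "mgf_sublevel = {\<theta> \<in> mgf_dom. mgf \<theta> \<le> 1}"

lemma mgf_domD: "\<theta> \<in> mgf_dom \<Longrightarrow> integrable M (\<lambda>\<omega>. exp (\<theta> \<bullet> Y \<omega>))"
  by (simp add: mgf_dom_def)

lemma zero_in_mgf_dom: "0 \<in> mgf_dom" and mgf_zero: "mgf 0 = 1"
  by (simp_all add: mgf_dom_def mgf_def prob_space)

lemma zero_in_mgf_sublevel: "0 \<in> mgf_sublevel"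
  by (simp add: mgf_sublevel_def zero_in_mgf_dom mgf_zero)

lemma nn_integral_exp:
  "\<theta> \<in> mgf_dom \<Longrightarrow> (\<integral>\<^sup>+\<omega>. ennreal (exp (\<theta> \<bullet> Y \<omega>)) \<partial>M) = ennreal (mgf \<theta>)"
  unfolding mgf_def by (intro nn_integral_eq_integral mgf_domD) auto

lemma mgf_dom_iff: "\<theta> \<in> mgf_dom \<longleftrightarrow> (\<integral>\<^sup>+\<omega>. ennreal (exp (\<theta> \<bullet> Y \<omega>)) \<partial>M) < \<infinity>"
  unfolding mgf_dom_def by (auto simp: integrable_iff_bounded)

lemma mgf_sublevel_iff: "\<theta> \<in> mgf_sublevel \<longleftrightarrow> (\<integral>\<^sup>+\<omega>. ennreal (exp (\<theta> \<bullet> Y \<omega>)) \<partial>M) \<le> 1"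
proof -
  have "\<theta> \<in> mgf_dom" if "(\<integral>\<^sup>+\<omega>. ennreal (exp (\<theta> \<bullet> Y \<omega>)) \<partial>M) \<le> 1"
    unfolding mgf_dom_iff using that by (rule order.strict_trans1) simp
  then show ?thesis
    unfolding mgf_sublevel_def
    by (auto simp: nn_integral_exp ennreal_le_1)
qed

lemma mgf_pos: "\<theta> \<in> mgf_dom \<Longrightarrow> mgf \<theta> > 0"
proof -
  assume \<theta>: "\<theta> \<in> mgf_dom"
  have "(\<integral>\<omega>. exp (\<theta> \<bullet> Y \<omega>) \<partial>M) > (\<integral>\<omega>. 0 \<partial>M)"
    using integral_less_AE_space[of "\<lambda>_. 0" "\<lambda>\<omega>. exp (\<theta> \<bullet> Y \<omega>)"] mgf_domD[OF \<theta>]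
    by (simp add: emeasure_space_1)
  then show ?thesis by (simp add: mgf_def)
qed

text \<open>The limit point is not known to lie in \<open>mgf_dom\<close>, so the argument is run
  with extended integrals, where Fatou's lemma gives the required lower semicontinuity.\<close>

lemma closed_mgf_sublevel: "closed mgf_sublevel"
  unfolding closed_sequential_limits
proof (intro allI impI; elim conjE)
  fix \<theta> l assume \<theta>: "\<forall>n. \<theta> n \<in> mgf_sublevel" "\<theta> \<longlonglongrightarrow> l"
  have "(\<integral>\<^sup>+\<omega>. ennreal (exp (l \<bullet> Y \<omega>)) \<partial>M) = (\<integral>\<^sup>+\<omega>. liminf (\<lambda>n. ennreal (exp (\<theta> n \<bullet> Y \<omega>))) \<partial>M)"
  proof (intro nn_integral_cong)
    fix \<omega>
    have "(\<lambda>n. ennreal (exp (\<theta> n \<bullet> Y \<omega>))) \<longlonglongrightarrow> ennreal (exp (l \<bullet> Y \<omega>))"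
      using \<theta>(2) by (intro tendsto_intros)
    then show "ennreal (exp (l \<bullet> Y \<omega>)) = liminf (\<lambda>n. ennreal (exp (\<theta> n \<bullet> Y \<omega>)))"
      by (simp only: lim_imp_Liminf[OF sequentially_bot])
  qed
  also have "\<dots> \<le> liminf (\<lambda>n. \<integral>\<^sup>+\<omega>. ennreal (exp (\<theta> n \<bullet> Y \<omega>)) \<partial>M)"
    by (intro nn_integral_liminf) measurable
  also have "\<dots> \<le> liminf (\<lambda>n. 1)"
    using \<theta>(1) by (intro Liminf_mono always_eventually) (simp add: mgf_sublevel_iff)
  also have "\<dots> = 1" by (simp add: Liminf_const)
  finally show "l \<in> mgf_sublevel" by (simp add: mgf_sublevel_iff)
qed

end

section \<open>Gradient, tangents and strict convexity on an open domain\<close>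

locale open_mgf = random_vector M Y
  for M :: "'a measure" and Y :: "'a \<Rightarrow> 'v::euclidean_space" +
  assumes open_dom: "open mgf_dom"
begin

lemma segment_in_mgf_dom:
  assumes "\<eta> \<in> mgf_dom"
  obtains s where "s > 0" "\<eta> + s *\<^sub>R h \<in> mgf_dom" "\<eta> - s *\<^sub>R h \<in> mgf_dom"
proof -
  obtain e where e: "e > 0" "ball \<eta> e \<subseteq> mgf_dom"
    using open_dom assms open_contains_ball by blast
  define s where "s = e / (norm h + 1) / 2"
  have "norm h < norm h + 1" by simp
  then have "s * norm h < e" using e(1)
    unfolding s_def by (simp add: field_simps add_pos_nonneg) (smt (verit) norm_ge_zero mult_nonneg_nonneg)
  moreover have "s > 0" using e(1) by (simp add: s_def add_nonneg_pos)
  ultimately have "\<eta> + s *\<^sub>R h \<in> ball \<eta> e" "\<eta> - s *\<^sub>R h \<in> ball \<eta> e"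
    by (auto simp: dist_norm)
  with e \<open>s > 0\<close> show ?thesis using that by blast
qed

text \<open>Openness supplies the dominating function: \<open>s * \<bar>z\<bar>\<close> is at most
  \<open>exp (s * z) + exp (- (s * z))\<close>, and both shifted parameters stay in the
  domain.\<close>

lemma integrable_exp_inner:
  assumes "\<eta> \<in> mgf_dom"
  shows "integrable M (\<lambda>\<omega>. exp (\<eta> \<bullet> Y \<omega>) * (h \<bullet> Y \<omega>))"
proof -
  obtain s where s: "s > 0" "\<eta> + s *\<^sub>R h \<in> mgf_dom" "\<eta> - s *\<^sub>R h \<in> mgf_dom"
    using segment_in_mgf_dom[OF assms] .
  have "integrable M (\<lambda>\<omega>. 1 / s * (exp ((\<eta> + s *\<^sub>R h) \<bullet> Y \<omega>) + exp ((\<eta> - s *\<^sub>R h) \<bullet> Y \<omega>)))"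
    using s by (intro integrable_mult_right Bochner_Integration.integrable_add mgf_domD)
  then show ?thesis
  proof (rule Bochner_Integration.integrable_bound, measurable, intro AE_I2)
    fix \<omega>
    have "s * \<bar>h \<bullet> Y \<omega>\<bar> \<le> exp (s * \<bar>h \<bullet> Y \<omega>\<bar>)"
      using exp_ge_add_one_self[of "s * \<bar>h \<bullet> Y \<omega>\<bar>"] by linarith
    also have "\<dots> \<le> exp (s * (h \<bullet> Y \<omega>)) + exp (- (s * (h \<bullet> Y \<omega>)))"
      by (cases "h \<bullet> Y \<omega> \<ge> 0") auto
    finally have "\<bar>h \<bullet> Y \<omega>\<bar> \<le> 1 / s * (exp (s * (h \<bullet> Y \<omega>)) + exp (- (s * (h \<bullet> Y \<omega>))))"
      using s by (simp add: field_simps)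
    from mult_left_mono[OF this, of "exp (\<eta> \<bullet> Y \<omega>)"]
    have "exp (\<eta> \<bullet> Y \<omega>) * \<bar>h \<bullet> Y \<omega>\<bar> \<le> 1 / s * (exp ((\<eta> + s *\<^sub>R h) \<bullet> Y \<omega>) + exp ((\<eta> - s *\<^sub>R h) \<bullet> Y \<omega>))"
      by (simp add: inner_add_left inner_diff_left exp_add exp_diff exp_minus field_simps)
    then show "norm (exp (\<eta> \<bullet> Y \<omega>) * (h \<bullet> Y \<omega>))
        \<le> norm (1 / s * (exp ((\<eta> + s *\<^sub>R h) \<bullet> Y \<omega>) + exp ((\<eta> - s *\<^sub>R h) \<bullet> Y \<omega>)))"
      using s by (simp add: abs_mult)
  qed
qed

lemma integrable_exp_scaleR:
  assumes "\<eta> \<in> mgf_dom"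
  shows "integrable M (\<lambda>\<omega>. exp (\<eta> \<bullet> Y \<omega>) *\<^sub>R Y \<omega>)"
proof -
  have "integrable M (\<lambda>\<omega>. \<Sum>b\<in>Basis. (exp (\<eta> \<bullet> Y \<omega>) * (b \<bullet> Y \<omega>)) *\<^sub>R b)"
    using integrable_exp_inner[OF assms] by (intro Bochner_Integration.integrable_sum integrable_scaleR_left)
  also have "(\<lambda>\<omega>. \<Sum>b\<in>Basis. (exp (\<eta> \<bullet> Y \<omega>) * (b \<bullet> Y \<omega>)) *\<^sub>R b) = (\<lambda>\<omega>. exp (\<eta> \<bullet> Y \<omega>) *\<^sub>R Y \<omega>)"
    by (simp add: inner_commute[of _ "Y _"] euclidean_representation flip: scaleR_scaleR scaleR_sum_right)
  finally show ?thesis .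
qed

lemma expectation_exp_inner:
  assumes "\<eta> \<in> mgf_dom"
  shows "expectation (\<lambda>\<omega>. exp (\<eta> \<bullet> Y \<omega>) * (h \<bullet> Y \<omega>)) = h \<bullet> tilted_mean \<eta>"
  unfolding tilted_mean_def
  using integral_inner_right[OF integrable_exp_scaleR[OF assms], of h, symmetric] by simp

text \<open>A one-sided bound of second order takes the place of differentiation under the integral;
  the matching lower bound comes from convexity in \<open>mgf_ge_exp_tangent\<close>.\<close>

lemma mgf_le_quadratic:
  assumes "\<eta> \<in> mgf_dom"
  obtains C s where "s > 0"
    "\<And>t. 0 < t \<Longrightarrow> t \<le> s \<Longrightarrow> \<eta> + t *\<^sub>R h \<in> mgf_dom \<and>
        mgf (\<eta> + t *\<^sub>R h) \<le> mgf \<eta> + t * (h \<bullet> tilted_mean \<eta>) + C * t\<^sup>2"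
proof -
  obtain s where s: "s > 0" "\<eta> + s *\<^sub>R h \<in> mgf_dom" "\<eta> - s *\<^sub>R h \<in> mgf_dom"
    using segment_in_mgf_dom[OF assms] .
  define R where "R \<omega> = 4 / s\<^sup>2 * (exp ((\<eta> + s *\<^sub>R h) \<bullet> Y \<omega>) + exp ((\<eta> - s *\<^sub>R h) \<bullet> Y \<omega>))" for \<omega>
  have R: "integrable M R"
    unfolding R_def using s by (intro integrable_mult_right Bochner_Integration.integrable_add mgf_domD)
  have "\<eta> + t *\<^sub>R h \<in> mgf_dom \<and>
        mgf (\<eta> + t *\<^sub>R h) \<le> mgf \<eta> + t * (h \<bullet> tilted_mean \<eta>) + expectation R * t\<^sup>2"
    if t: "0 < t" "t \<le> s / 2" for t
  proof -
    let ?B = "\<lambda>\<omega>. exp (\<eta> \<bullet> Y \<omega>) + t * (exp (\<eta> \<bullet> Y \<omega>) * (h \<bullet> Y \<omega>)) + t\<^sup>2 * R \<omega>"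
    have B: "integrable M ?B"
      using R assms by (intro integrable_mult_right Bochner_Integration.integrable_add mgf_domD integrable_exp_inner)
    have le: "exp ((\<eta> + t *\<^sub>R h) \<bullet> Y \<omega>) \<le> ?B \<omega>" for \<omega>
      using mult_left_mono[OF exp_le_quadratic[OF t, of "h \<bullet> Y \<omega>"], of "exp (\<eta> \<bullet> Y \<omega>)"]
      by (simp add: R_def inner_add_left inner_diff_left exp_add exp_diff exp_minus field_simps)
    have "integrable M (\<lambda>\<omega>. exp ((\<eta> + t *\<^sub>R h) \<bullet> Y \<omega>))"
      using B
    proof (rule Bochner_Integration.integrable_bound, measurable, intro AE_I2)
      fix \<omega> show "norm (exp ((\<eta> + t *\<^sub>R h) \<bullet> Y \<omega>)) \<le> norm (?B \<omega>)"
        using order_trans[OF le[of \<omega>] abs_ge_self] by simp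
    qed
    moreover from this have "mgf (\<eta> + t *\<^sub>R h) \<le> expectation ?B"
      unfolding mgf_def using B le by (intro integral_mono)
    moreover have "expectation ?B = mgf \<eta> + t * (h \<bullet> tilted_mean \<eta>) + t\<^sup>2 * expectation R"
      using R assms integrable_exp_inner[OF assms, of h] mgf_domD[OF assms]
      by (simp add: mgf_def expectation_exp_inner)
    ultimately show ?thesis by (simp add: mgf_dom_def mult.commute)
  qed
  then show ?thesis using that[of "s / 2" "expectation R"] s(1) by auto
qed

lemma eventually_mgf_less:
  assumes \<eta>: "\<eta> \<in> mgf_dom" and a: "h \<bullet> tilted_mean \<eta> < a"
  shows "eventually (\<lambda>t. \<eta> + t *\<^sub>R h \<in> mgf_dom \<and> mgf (\<eta> + t *\<^sub>R h) < mgf \<eta> + t * a) (at_right 0)"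
proof -
  obtain C s where s: "s > 0" and C: "\<And>t. 0 < t \<Longrightarrow> t \<le> s \<Longrightarrow> \<eta> + t *\<^sub>R h \<in> mgf_dom \<and>
        mgf (\<eta> + t *\<^sub>R h) \<le> mgf \<eta> + t * (h \<bullet> tilted_mean \<eta>) + C * t\<^sup>2"
    using mgf_le_quadratic[OF \<eta>] by blast
  define d where "d = a - h \<bullet> tilted_mean \<eta>"
  have d: "d > 0" using a by (simp add: d_def)
  define s' where "s' = min s (d / (\<bar>C\<bar> + 1))"
  have "s' > 0" using s d by (simp add: s'_def)
  then show ?thesis unfolding eventually_at_right_field
  proof (intro exI[of _ s'] conjI allI impI)
    fix t assume t: "0 < t" "t < s'"
    then have t': "t \<le> s" "t < d / (\<bar>C\<bar> + 1)" by (auto simp: s'_def)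
    have "C * t \<le> (\<bar>C\<bar> + 1) * t" using t by (intro mult_right_mono) auto
    also have "\<dots> < d" using t' by (simp add: field_simps)
    finally have "C * t\<^sup>2 < d * t" using t by (simp add: power2_eq_square)
    with C[of t] t t' show "\<eta> + t *\<^sub>R h \<in> mgf_dom" "mgf (\<eta> + t *\<^sub>R h) < mgf \<eta> + t * a"
      by (auto simp: d_def algebra_simps)
  qed
qed

text \<open>Jensen's inequality under the tilting by \<open>\<eta>\<close>, a probability because
  \<open>mgf \<eta> = 1\<close>. With \<open>a\<close> the tilted mean of
  \<open>(\<theta> - \<eta>) \<bullet> Y\<close>, it follows by integrating
  \<open>1 + (z - a) \<le> exp (z - a)\<close>.\<close>

lemma mgf_ge_exp_tangent:
  assumes "\<eta> \<in> mgf_dom" "mgf \<eta> = 1" "\<theta> \<in> mgf_dom"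
  shows "mgf \<theta> \<ge> exp ((\<theta> - \<eta>) \<bullet> tilted_mean \<eta>)"
proof -
  define a where "a = (\<theta> - \<eta>) \<bullet> tilted_mean \<eta>"
  let ?B = "\<lambda>\<omega>. exp a * ((1 - a) * exp (\<eta> \<bullet> Y \<omega>) + exp (\<eta> \<bullet> Y \<omega>) * ((\<theta> - \<eta>) \<bullet> Y \<omega>))"
  have i: "integrable M ?B"
    using assms by (intro integrable_mult_right Bochner_Integration.integrable_add mgf_domD integrable_exp_inner)
  have "expectation ?B = exp a * ((1 - a) * mgf \<eta> + a)"
    using assms integrable_exp_inner[OF assms(1), of "\<theta> - \<eta>"] mgf_domD[OF assms(1)]
    by (simp add: mgf_def expectation_exp_inner a_def)
  also have "\<dots> = exp a" using assms by simp
  finally have "exp a = expectation ?B" by simp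
  also have "\<dots> \<le> mgf \<theta>"
    unfolding mgf_def
  proof (intro integral_mono i mgf_domD assms)
    fix \<omega>
    have "1 + ((\<theta> - \<eta>) \<bullet> Y \<omega> - a) \<le> exp ((\<theta> - \<eta>) \<bullet> Y \<omega> - a)" by (rule exp_ge_add_one_self)
    from mult_left_mono[OF this, of "exp a * exp (\<eta> \<bullet> Y \<omega>)"]
    have "?B \<omega> \<le> exp a * exp (\<eta> \<bullet> Y \<omega>) * exp ((\<theta> - \<eta>) \<bullet> Y \<omega> - a)"
      by (simp add: algebra_simps)
    also have "\<dots> = exp (\<theta> \<bullet> Y \<omega>)"
      by (simp add: inner_diff_left flip: exp_add)
    finally show "?B \<omega> \<le> exp (\<theta> \<bullet> Y \<omega>)" .
  qed
  finally show ?thesis by (simp add: a_def)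
qed

text \<open>Lagrange multipliers: \<open>tilted_mean \<eta>\<close> is the gradient of \<open>mgf\<close> at \<open>\<eta>\<close>.\<close>

lemma sublevel_maximiser:
  assumes x: "x \<noteq> 0" and bdd: "bounded {\<theta> \<in> mgf_sublevel. 0 \<le> \<theta> \<bullet> x}"
    and \<theta>0: "\<theta>0 \<in> mgf_dom" "mgf \<theta>0 < 1"
  obtains \<eta> c where "\<eta> \<in> mgf_dom" "mgf \<eta> = 1" "c > 0" "x = c *\<^sub>R tilted_mean \<eta>"
    "\<And>\<theta>. \<theta> \<in> mgf_sublevel \<Longrightarrow> \<theta> \<bullet> x \<le> \<eta> \<bullet> x"
proof -
  let ?S = "{\<theta> \<in> mgf_sublevel. 0 \<le> \<theta> \<bullet> x}"
  have "?S = mgf_sublevel \<inter> {\<theta>. x \<bullet> \<theta> \<ge> 0}" by (auto simp: inner_commute)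
  then have "closed ?S"
    using closed_mgf_sublevel closed_halfspace_ge[where a = x and b = 0] by auto
  with bdd have "compact ?S" by (simp add: compact_eq_bounded_closed)
  moreover have "0 \<in> ?S" using zero_in_mgf_sublevel by simp
  moreover have "continuous_on ?S (\<lambda>\<theta>. \<theta> \<bullet> x)" by (intro continuous_intros)
  ultimately obtain \<eta> where \<eta>: "\<eta> \<in> ?S" "\<And>\<theta>. \<theta> \<in> ?S \<Longrightarrow> \<theta> \<bullet> x \<le> \<eta> \<bullet> x"
    using continuous_attains_sup[of ?S "\<lambda>\<theta>. \<theta> \<bullet> x"] by blast
  have max: "\<theta> \<bullet> x \<le> \<eta> \<bullet> x" if "\<theta> \<in> mgf_sublevel" for \<theta>
    using \<eta> that by (cases "0 \<le> \<theta> \<bullet> x") auto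
  have dom: "\<eta> \<in> mgf_dom" and le: "mgf \<eta> \<le> 1" using \<eta> by (auto simp: mgf_sublevel_def)
  \<comment> \<open>If the constraint were slack, a small step from \<open>\<eta>\<close> in
    direction \<open>x\<close> would stay in the sublevel set and increase the objective.\<close>
  have eq: "mgf \<eta> = 1"
  proof (rule ccontr)
    assume "mgf \<eta> \<noteq> 1"
    then have lt: "mgf \<eta> < 1" using le by simp
    define a where "a = x \<bullet> tilted_mean \<eta> + 1"
    have "eventually (\<lambda>t. \<eta> + t *\<^sub>R x \<in> mgf_dom \<and> mgf (\<eta> + t *\<^sub>R x) < mgf \<eta> + t * a) (at_right 0)"
      by (rule eventually_mgf_less[OF dom]) (simp add: a_def)
    moreover have "((\<lambda>t. mgf \<eta> + t * a) \<longlongrightarrow> mgf \<eta> + 0 * a) (at_right 0)"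
      by (intro tendsto_intros)
    then have "eventually (\<lambda>t. mgf \<eta> + t * a < 1) (at_right 0)"
      using lt by (intro order_tendstoD(2)[of _ "mgf \<eta> + 0 * a"]) auto
    moreover have "eventually (\<lambda>t::real. 0 < t) (at_right 0)" by (simp add: eventually_at_right_less)
    ultimately have "eventually (\<lambda>t::real. False) (at_right 0)"
    proof eventually_elim
      case (elim t)
      then have "\<eta> + t *\<^sub>R x \<in> mgf_sublevel" by (simp add: mgf_sublevel_def)
      from max[OF this] have "t * (x \<bullet> x) \<le> 0" by (simp add: inner_add_left)
      moreover have "t * (x \<bullet> x) > 0" using elim x by simp
      ultimately show False by simp
    qed
    then show False by (simp add: eventually_False)
  qed
  \<comment> \<open>\<open>\<theta>0\<close> is a Slater point: lying strictly below level 1, it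
    forces the gradient at the boundary point \<open>\<eta>\<close> to be nonzero.\<close>
  have "(\<theta>0 - \<eta>) \<bullet> tilted_mean \<eta> < 0"
    using order.strict_trans1[OF mgf_ge_exp_tangent[OF dom eq \<theta>0(1)] \<theta>0(2)] by simp
  then have "tilted_mean \<eta> \<noteq> 0" by auto
  moreover have "h \<bullet> x \<le> 0" if "h \<bullet> tilted_mean \<eta> < 0" for h
  proof -
    have "eventually (\<lambda>t. \<eta> + t *\<^sub>R h \<in> mgf_dom \<and> mgf (\<eta> + t *\<^sub>R h) < mgf \<eta> + t * 0) (at_right 0)"
      by (rule eventually_mgf_less[OF dom that])
    moreover have "eventually (\<lambda>t::real. 0 < t) (at_right 0)" by (simp add: eventually_at_right_less)
    ultimately have "eventually (\<lambda>t::real. h \<bullet> x \<le> 0) (at_right 0)"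
    proof eventually_elim
      case (elim t)
      then have "\<eta> + t *\<^sub>R h \<in> mgf_sublevel" using eq by (simp add: mgf_sublevel_def)
      from max[OF this] have "t * (h \<bullet> x) \<le> 0" by (simp add: inner_add_left)
      then show ?case using elim by (simp add: mult_le_0_iff)
    qed
    then show ?thesis by simp
  qed
  ultimately obtain c where "c > 0" "x = c *\<^sub>R tilted_mean \<eta>"
    using farkas_single[OF _ x] by blast
  then show ?thesis using that dom eq max by blast
qed

lemma tangent_inequality:
  assumes "\<eta> \<in> mgf_dom" "mgf \<eta> = 1" "\<theta> \<in> mgf_dom"
  shows "(\<theta> - \<eta>) \<bullet> tilted_mean \<eta> \<le> ln (mgf \<theta>)"
  using mgf_ge_exp_tangent[OF assms] mgf_pos[OF assms(3)] by (simp add: ln_ge_iff)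

text \<open>Cauchy-Schwarz with its equality case, obtained from the arithmetic-geometric mean
  inequality for the normalised densities \<open>p\<close> and \<open>q\<close> of the two tiltings.
  If the geometric mean has integral 1 as well, then \<open>p = q\<close> almost surely, and taking
  logarithms makes \<open>(\<theta> - \<theta>') \<bullet> Y\<close> constant.\<close>

lemma ln_mgf_midpoint:
  assumes "\<theta> \<in> mgf_dom" "\<theta>' \<in> mgf_dom"
    and "\<And>c. \<not> (AE \<omega> in M. (\<theta> - \<theta>') \<bullet> Y \<omega> = c)"
  shows "(1/2) *\<^sub>R (\<theta> + \<theta>') \<in> mgf_dom"
    and "ln (mgf ((1/2) *\<^sub>R (\<theta> + \<theta>'))) < (ln (mgf \<theta>) + ln (mgf \<theta>')) / 2"
proof -
  let ?m = "(1/2) *\<^sub>R (\<theta> + \<theta>')"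
  define p where "p \<omega> = exp (\<theta> \<bullet> Y \<omega>) / mgf \<theta>" for \<omega>
  define q where "q \<omega> = exp (\<theta>' \<bullet> Y \<omega>) / mgf \<theta>'" for \<omega>
  define K where "K = sqrt (mgf \<theta>) * sqrt (mgf \<theta>')"
  have pos: "mgf \<theta> > 0" "mgf \<theta>' > 0" using assms mgf_pos by auto
  then have K: "K > 0" by (simp add: K_def)
  have p: "integrable M p" "expectation p = 1" and q: "integrable M q" "expectation q = 1"
    using assms(1,2) pos by (simp_all add: p_def[abs_def] q_def[abs_def] mgf_def mgf_dom_def)
  have sq: "exp (?m \<bullet> Y \<omega>) = K * (sqrt (p \<omega>) * sqrt (q \<omega>))" for \<omega>
  proof (rule power2_eq_imp_eq)
    have "(exp (?m \<bullet> Y \<omega>))\<^sup>2 = exp (\<theta> \<bullet> Y \<omega> + \<theta>' \<bullet> Y \<omega>)"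
      by (simp add: inner_add_left flip: exp_double)
    then show "(exp (?m \<bullet> Y \<omega>))\<^sup>2 = (K * (sqrt (p \<omega>) * sqrt (q \<omega>)))\<^sup>2"
      using pos by (simp add: K_def p_def q_def power_mult_distrib exp_add)
  qed (use K pos in \<open>simp_all add: p_def q_def\<close>)
  have diff: "(p \<omega> + q \<omega>) / 2 - sqrt (p \<omega>) * sqrt (q \<omega>) = (sqrt (p \<omega>) - sqrt (q \<omega>))\<^sup>2 / 2" for \<omega>
    using pos by (simp add: p_def q_def power2_diff field_simps)
  have am: "sqrt (p \<omega>) * sqrt (q \<omega>) \<le> (p \<omega> + q \<omega>) / 2" for \<omega>
    using diff[of \<omega>] by (smt (verit) divide_nonneg_nonneg zero_le_power2)
  have ipq: "integrable M (\<lambda>\<omega>. (p \<omega> + q \<omega>) / 2)" "expectation (\<lambda>\<omega>. (p \<omega> + q \<omega>) / 2) = 1"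
    using p q by simp_all
  have i: "integrable M (\<lambda>\<omega>. sqrt (p \<omega>) * sqrt (q \<omega>))"
    using ipq(1)
  proof (rule Bochner_Integration.integrable_bound)
    show "(\<lambda>\<omega>. sqrt (p \<omega>) * sqrt (q \<omega>)) \<in> borel_measurable M"
      unfolding p_def q_def by measurable
    show "AE \<omega> in M. norm (sqrt (p \<omega>) * sqrt (q \<omega>)) \<le> norm ((p \<omega> + q \<omega>) / 2)"
      using am pos by (intro AE_I2) (auto simp: p_def q_def abs_mult)
  qed
  then show m: "?m \<in> mgf_dom"
    unfolding mgf_dom_def mem_Collect_eq sq by (rule integrable_mult_right)
  have mm: "mgf ?m = K * expectation (\<lambda>\<omega>. sqrt (p \<omega>) * sqrt (q \<omega>))"
    unfolding mgf_def sq by simp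
  have "expectation (\<lambda>\<omega>. sqrt (p \<omega>) * sqrt (q \<omega>)) \<le> 1"
    using integral_mono[OF i ipq(1) am] ipq(2) by simp
  moreover have "expectation (\<lambda>\<omega>. sqrt (p \<omega>) * sqrt (q \<omega>)) \<noteq> 1"
  proof
    assume *: "expectation (\<lambda>\<omega>. sqrt (p \<omega>) * sqrt (q \<omega>)) = 1"
    have "AE \<omega> in M. (p \<omega> + q \<omega>) / 2 - sqrt (p \<omega>) * sqrt (q \<omega>) = 0"
      using * i ipq am
      by (subst integral_nonneg_eq_0_iff_AE[symmetric]) (auto intro: Bochner_Integration.integrable_diff)
    then have "AE \<omega> in M. (\<theta> - \<theta>') \<bullet> Y \<omega> = ln (mgf \<theta>) - ln (mgf \<theta>')"
    proof eventually_elim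
      case (elim \<omega>)
      then have "p \<omega> = q \<omega>" unfolding diff by simp
      then have "ln (exp (\<theta> \<bullet> Y \<omega>) / mgf \<theta>) = ln (exp (\<theta>' \<bullet> Y \<omega>) / mgf \<theta>')"
        by (simp add: p_def q_def)
      then show ?case using pos by (simp add: ln_div inner_diff_left)
    qed
    with assms(3) show False by blast
  qed
  ultimately have "mgf ?m < K" using K unfolding mm by simp
  then have "ln (mgf ?m) < ln K" using mgf_pos[OF m] K by simp
  also have "ln K = (ln (mgf \<theta>) + ln (mgf \<theta>')) / 2"
    using pos by (simp add: K_def ln_mult ln_sqrt)
  finally show "ln (mgf ?m) < (ln (mgf \<theta>) + ln (mgf \<theta>')) / 2" .
qed

end

section \<open>Near-optimal points of a target set\<close>

lemma finite_uniform_lower_bound: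
  fixes f :: "'i \<Rightarrow> real"
  assumes "finite A" "\<And>i. i \<in> A \<Longrightarrow> f i > 0"
  obtains k where "k > 0" "\<And>i. i \<in> A \<Longrightarrow> k \<le> f i"
proof
  show "Min (insert 1 (f ` A)) > 0" using assms by (subst Min_gr_iff) auto
  show "\<And>i. i \<in> A \<Longrightarrow> Min (insert 1 (f ` A)) \<le> f i" using assms(1) by simp
qed

lemma finite_uniform_upper_bound:
  fixes f :: "'i \<Rightarrow> real"
  assumes "finite A"
  obtains k where "k > 0" "\<And>i. i \<in> A \<Longrightarrow> f i \<le> k"
proof
  show "Max (insert 1 (f ` A)) > 0" using assms by (subst Max_gr_iff) auto
  show "\<And>i. i \<in> A \<Longrightarrow> f i \<le> Max (insert 1 (f ` A))" using assms by simp
qed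

text \<open>The estimates below each concern one direction; this reduces a norm to finitely many of
  them.\<close>

lemma norm_le_DIM_signed_coordinate:
  fixes x :: "'v::euclidean_space"
  obtains v where "v \<in> Basis \<union> uminus ` Basis" "norm x \<le> DIM('v) * (v \<bullet> x)"
proof -
  have "\<exists>b\<in>Basis. norm x \<le> DIM('v) * \<bar>x \<bullet> b\<bar>"
  proof (rule ccontr)
    assume "\<not> ?thesis"
    then have "(\<Sum>b\<in>(Basis::'v set). DIM('v) * \<bar>x \<bullet> b\<bar>) < (\<Sum>b\<in>(Basis::'v set). norm x)"
      by (intro sum_strict_mono) auto
    then have "(\<Sum>b\<in>(Basis::'v set). \<bar>x \<bullet> b\<bar>) < norm x"
      by (simp flip: sum_distrib_left)
    with norm_le_l1[of x] show False by simp
  qed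
  then obtain b where b: "b \<in> Basis" "norm x \<le> DIM('v) * \<bar>x \<bullet> b\<bar>" by blast
  show ?thesis
  proof (cases "x \<bullet> b \<ge> 0")
    case True
    with b show ?thesis using that[of b] by (simp add: inner_commute)
  next
    case False
    with b show ?thesis using that[of "- b"] by (simp add: inner_commute)
  qed
qed

lemma open_pos_cone:
  fixes A :: "'v::real_normed_vector set"
  assumes "open A"
  shows "open (pos_cone A)"
proof -
  have "pos_cone A = (\<Union>c\<in>{0<..}. (*\<^sub>R) c ` A)"
    unfolding pos_cone_def by auto
  also have "open \<dots>"
    using assms by (intro open_UN ballI open_scaling) auto
  finally show ?thesis .
qed

lemma pos_cone_scaleR:
  assumes "x \<in> pos_cone A" "c > 0"
  shows "c *\<^sub>R x \<in> pos_cone A"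
proof -
  obtain d y where "d > 0" "y \<in> A" "x = d *\<^sub>R y" using assms unfolding pos_cone_def by blast
  then show ?thesis unfolding pos_cone_def using assms(2)
    by (intro CollectI exI[of _ "c * d"] exI[of _ y]) simp
qed

section \<open>Positivity of the rate and choice of the near-optimal point\<close>

context open_mgf
begin

text \<open>Slater point for the Lagrange argument: at 0 the value is 1, and a small step against
  the mean lowers it.\<close>

lemma mgf_less_1_exists:
  assumes "tilted_mean 0 \<noteq> 0"
  obtains \<theta> where "\<theta> \<in> mgf_dom" "mgf \<theta> < 1"
proof -
  have "eventually (\<lambda>t. 0 + t *\<^sub>R (- tilted_mean 0) \<in> mgf_dom \<and>
      mgf (0 + t *\<^sub>R (- tilted_mean 0)) < mgf 0 + t * 0) (at_right 0)"
    using assms by (intro eventually_mgf_less zero_in_mgf_dom) simp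
  then obtain t where "0 + t *\<^sub>R (- tilted_mean 0) \<in> mgf_dom"
      "mgf (0 + t *\<^sub>R (- tilted_mean 0)) < mgf 0 + t * 0"
    using eventually_happens'[OF trivial_limit_at_right_real] by blast
  then show ?thesis using that by (simp add: mgf_zero)
qed

text \<open>This makes the minimal rate positive under \<open>cond_C1\<close> and
  \<open>cond_C3\<close>. A unit vector \<open>e\<close> off the cone is no positive multiple of the
  mean, so by \<open>farkas_single\<close> some \<open>h\<close> has
  \<open>h \<bullet> tilted_mean 0 < 0 < h \<bullet> e\<close>, and a small multiple of
  \<open>h\<close> lies in the sublevel set. Compactness of the sphere without the open cone makes
  the bound uniform, and homogeneity carries it to longer vectors.\<close>

lemma support_positive_off_mean_cone:
  assumes \<mu>: "tilted_mean 0 \<noteq> 0" and \<delta>: "\<delta> > 0" "\<delta>' > 0"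
  obtains r where "r > 0"
    "\<And>x. \<delta> \<le> norm x \<Longrightarrow> x \<notin> pos_cone (ball (tilted_mean 0) \<delta>') \<Longrightarrow> \<exists>\<theta>\<in>mgf_sublevel. r \<le> \<theta> \<bullet> x"
proof -
  let ?C = "pos_cone (ball (tilted_mean 0) \<delta>')"
  define K where "K = sphere 0 1 - ?C"
  define U where "U n = (\<Union>\<theta>\<in>mgf_sublevel. {y. \<theta> \<bullet> y > 1 / real (Suc n)})" for n
  have "compact K" unfolding K_def
    by (intro compact_diff open_pos_cone) auto
  moreover have "open (U n)" for n
    unfolding U_def by (intro open_UN ballI open_halfspace_gt)
  moreover have "K \<subseteq> (\<Union>n. U n)"
  proof
    fix e assume e: "e \<in> K"
    have "\<exists>h. h \<bullet> tilted_mean 0 < 0 \<and> h \<bullet> e > 0"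
    proof (rule ccontr)
      assume "\<not> ?thesis"
      then have *: "\<And>h. h \<bullet> tilted_mean 0 < 0 \<Longrightarrow> h \<bullet> e \<le> 0" by force
      have "e \<noteq> 0" using e by (auto simp: K_def)
      from farkas_single[OF \<mu> this *] obtain c where "c > 0" "e = c *\<^sub>R tilted_mean 0" by blast
      then have "e \<in> ?C" unfolding pos_cone_def using \<delta> by fastforce
      with e show False by (simp add: K_def)
    qed
    then obtain h where h: "h \<bullet> tilted_mean 0 < 0" "h \<bullet> e > 0" by blast
    have "eventually (\<lambda>t. 0 + t *\<^sub>R h \<in> mgf_dom \<and> mgf (0 + t *\<^sub>R h) < mgf 0 + t * 0) (at_right 0)"
      using h by (intro eventually_mgf_less zero_in_mgf_dom) simp
    moreover have "eventually (\<lambda>t::real. 0 < t) (at_right 0)" by (simp add: eventually_at_right_less)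
    ultimately have "eventually (\<lambda>t. t *\<^sub>R h \<in> mgf_sublevel \<and> 0 < t) (at_right 0)"
      by eventually_elim (simp add: mgf_sublevel_def mgf_zero)
    then obtain t where t: "t *\<^sub>R h \<in> mgf_sublevel" "t > 0"
      using eventually_happens'[OF trivial_limit_at_right_real] by blast
    then have "0 < (t *\<^sub>R h) \<bullet> e" using h by simp
    then obtain n where "inverse (real (Suc n)) < (t *\<^sub>R h) \<bullet> e" using reals_Archimedean by blast
    then have "e \<in> U n" unfolding U_def using t(1) by (intro UN_I[of "t *\<^sub>R h"]) (auto simp: inverse_eq_divide)
    then show "e \<in> (\<Union>n. U n)" by blast
  qed
  ultimately obtain N where N: "finite N" "K \<subseteq> (\<Union>n\<in>N. U n)"
    using compactE_image[of K UNIV U] by auto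
  define m where "m = Max (insert 0 N)"
  show ?thesis
  proof (rule that[of "\<delta> / real (Suc m)"])
    show "\<delta> / real (Suc m) > 0" using \<delta> by simp
    fix x assume x: "\<delta> \<le> norm x" "x \<notin> ?C"
    have nx: "norm x > 0" using x \<delta> by linarith
    define e where "e = (1 / norm x) *\<^sub>R x"
    have xe: "x = norm x *\<^sub>R e" using nx by (simp add: e_def)
    have "e \<notin> ?C" using pos_cone_scaleR[of e _ "norm x"] x(2) nx xe by auto
    then have "e \<in> K" using nx by (simp add: K_def e_def)
    then obtain n \<theta> where n: "n \<in> N" "\<theta> \<in> mgf_sublevel" "\<theta> \<bullet> e > 1 / real (Suc n)"
      using N by (auto simp: U_def)
    have "n \<le> m" using n N by (simp add: m_def)
    then have "1 / real (Suc m) \<le> \<theta> \<bullet> e"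
      using n(3) by (smt (verit) frac_le of_nat_0_less_iff of_nat_mono zero_less_Suc Suc_le_mono)
    then have "\<delta> * (1 / real (Suc m)) \<le> norm x * (\<theta> \<bullet> e)"
      using x(1) \<delta> by (intro mult_mono) auto
    also have "\<dots> = \<theta> \<bullet> x" by (subst (2) xe) simp
    finally show "\<exists>\<theta>\<in>mgf_sublevel. \<delta> / real (Suc m) \<le> \<theta> \<bullet> x" using n(2) by auto
  qed
qed

text \<open>Along near-optimal points the multiplier \<open>c\<close> stays away from \<open>0\<close>: otherwise the maximum of a
  nonzero linear functional would be attained at \<open>\<beta>\<close>, in the interior of \<open>mgf_dom\<close>.\<close>

lemma multiplier_lower_bound:
  assumes \<beta>: "\<beta> \<in> mgf_dom" and \<delta>: "\<delta> > 0"
  obtains a K where "a > 0" "K > 0"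
    "\<And>\<eta> c x. \<eta> \<in> mgf_dom \<Longrightarrow> mgf \<eta> = 1 \<Longrightarrow> c > 0 \<Longrightarrow> x = c *\<^sub>R tilted_mean \<eta> \<Longrightarrow> \<delta> \<le> norm x \<Longrightarrow>
       a \<le> c * K + (\<eta> - \<beta>) \<bullet> x"
proof -
  let ?V = "Basis \<union> uminus ` Basis :: 'v set"
  have "\<exists>s>0. \<beta> + s *\<^sub>R v \<in> mgf_dom" for v
    using segment_in_mgf_dom[OF \<beta>, of v] by blast
  then obtain s where s: "\<And>v. s v > 0" "\<And>v. \<beta> + s v *\<^sub>R v \<in> mgf_dom" by metis
  obtain s0 where s0: "s0 > 0" "\<And>v. v \<in> ?V \<Longrightarrow> s0 \<le> s v"
    using finite_uniform_lower_bound[of ?V s] s(1) by auto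
  obtain K where K: "K > 0" "\<And>v. v \<in> ?V \<Longrightarrow> ln (mgf (\<beta> + s v *\<^sub>R v)) \<le> K"
    using finite_uniform_upper_bound[of ?V "\<lambda>v. ln (mgf (\<beta> + s v *\<^sub>R v))"] by auto
  show ?thesis
  proof (rule that[of "s0 * (\<delta> / DIM('v))" K])
    show "s0 * (\<delta> / DIM('v)) > 0" "K > 0" using s0 \<delta> K by auto
    fix \<eta> c x assume \<eta>: "\<eta> \<in> mgf_dom" "mgf \<eta> = 1" and c: "c > 0" and x: "x = c *\<^sub>R tilted_mean \<eta>" "\<delta> \<le> norm x"
    \<comment> \<open>Along \<open>v\<close> the vector \<open>x\<close> has a component of at least
      \<open>\<delta> / DIM('v)\<close>. The tangent inequality at
      \<open>\<beta> + s v *\<^sub>R v\<close>, a point still in the domain, charges this component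
      to \<open>c * K + (\<eta> - \<beta>) \<bullet> x\<close>.\<close>
    obtain v where v: "v \<in> ?V" "norm x \<le> DIM('v) * (v \<bullet> x)"
      using norm_le_DIM_signed_coordinate[of x] by blast
    have "\<delta> \<le> (v \<bullet> x) * DIM('v)" using v x by (simp add: mult.commute)
    then have "\<delta> / DIM('v) \<le> v \<bullet> x" by (simp add: divide_le_eq)
    then have "s0 * (\<delta> / DIM('v)) \<le> s v * (v \<bullet> x)"
      using s0 v \<delta> less_imp_le[OF s(1)] by (intro mult_mono) auto
    moreover have "c * ((\<beta> + s v *\<^sub>R v - \<eta>) \<bullet> tilted_mean \<eta>) \<le> c * K"
      using tangent_inequality[OF \<eta> s(2)[of v]] K(2)[OF v(1)] c by (intro mult_left_mono) auto
    then have "(\<beta> + s v *\<^sub>R v - \<eta>) \<bullet> x \<le> c * K" by (simp add: x)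
    ultimately show "s0 * (\<delta> / DIM('v)) \<le> c * K + (\<eta> - \<beta>) \<bullet> x"
      by (simp add: inner_add_left inner_diff_left)
  qed
qed

text \<open>Compactness gained from mixing some \<open>x0\<close> into \<open>x1\<close>: as
  \<open>\<theta> \<bullet> x1\<close> is bounded above, nonnegativity on the mixture bounds
  \<open>\<theta> \<bullet> x0\<close> from below. The upper bounds at the points
  \<open>x0 + (e / 2) *\<^sub>R v\<close> then bound every signed coordinate of
  \<open>\<theta>\<close>.\<close>

lemma bounded_sublevel_halfspace:
  assumes t: "t > 0" "t < 1"
    and x1: "\<And>\<theta>. \<theta> \<in> mgf_sublevel \<Longrightarrow> \<theta> \<bullet> x1 \<le> B"
    and x0: "e > 0" "\<And>y. y \<in> ball x0 e \<Longrightarrow> \<exists>B. \<forall>\<theta>\<in>mgf_sublevel. \<theta> \<bullet> y \<le> B"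
  shows "bounded {\<theta> \<in> mgf_sublevel. 0 \<le> \<theta> \<bullet> ((1 - t) *\<^sub>R x1 + t *\<^sub>R x0)}"
proof -
  let ?V = "Basis \<union> uminus ` Basis :: 'v set"
  have "\<exists>B. \<forall>\<theta>\<in>mgf_sublevel. \<theta> \<bullet> (x0 + (e / 2) *\<^sub>R v) \<le> B" if "v \<in> ?V" for v
    using that x0 by (intro x0(2)) (auto simp: dist_norm)
  then obtain B' where B': "\<And>v \<theta>. v \<in> ?V \<Longrightarrow> \<theta> \<in> mgf_sublevel \<Longrightarrow> \<theta> \<bullet> (x0 + (e / 2) *\<^sub>R v) \<le> B' v"
    by metis
  obtain K where K: "K > 0" "\<And>v. v \<in> ?V \<Longrightarrow> B' v \<le> K"
    using finite_uniform_upper_bound[of ?V B'] by auto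
  define L where "L = (1 - t) * B / t"
  show ?thesis
  proof (rule boundedI)
    fix \<theta> assume "\<theta> \<in> {\<theta> \<in> mgf_sublevel. 0 \<le> \<theta> \<bullet> ((1 - t) *\<^sub>R x1 + t *\<^sub>R x0)}"
    then have \<theta>: "\<theta> \<in> mgf_sublevel" "0 \<le> (1 - t) * (\<theta> \<bullet> x1) + t * (\<theta> \<bullet> x0)"
      by (auto simp: inner_add_right)
    have "(1 - t) * (\<theta> \<bullet> x1) \<le> (1 - t) * B" using x1[OF \<theta>(1)] t by (intro mult_left_mono) auto
    with \<theta>(2) have "- ((1 - t) * B) \<le> t * (\<theta> \<bullet> x0)" by linarith
    then have L: "- L \<le> \<theta> \<bullet> x0" unfolding L_def using t by (simp add: field_simps)
    obtain v where v: "v \<in> ?V" "norm \<theta> \<le> DIM('v) * (v \<bullet> \<theta>)"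
      using norm_le_DIM_signed_coordinate[of \<theta>] by blast
    have "\<theta> \<bullet> x0 + (e / 2) * (v \<bullet> \<theta>) \<le> K"
      using order_trans[OF B'[OF v(1) \<theta>(1)] K(2)[OF v(1)]] by (simp add: inner_add_right inner_commute)
    then have "(e / 2) * (v \<bullet> \<theta>) \<le> K + L" using L by linarith
    then have "v \<bullet> \<theta> \<le> (K + L) / (e / 2)" using x0(1) by (simp add: field_simps)
    then have "DIM('v) * (v \<bullet> \<theta>) \<le> DIM('v) * ((K + L) / (e / 2))" by (intro mult_left_mono) auto
    with v(2) show "norm \<theta> \<le> DIM('v) * ((K + L) / (e / 2))" by linarith
  qed
qed

text \<open>At a near-optimal \<open>x = c *\<^sub>R tilted_mean \<eta>\<close>, the tangent inequality at the midpoint of \<open>\<theta>\<close> and \<open>\<beta>\<close>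
  and strict convexity between them give
  \<open>\<theta> \<bullet> x - c * ln (mgf \<theta>) \<le> 2 * (\<eta> \<bullet> x) - r - 2 * c * \<kappa>\<close>, where \<open>\<eta> \<bullet> x\<close> is close to \<open>r\<close>.\<close>

lemma cost_below_twice_rate:
  assumes W: "convex W" "\<delta> > 0" "\<And>x. x \<in> W \<Longrightarrow> \<delta> \<le> norm x"
    and \<beta>: "\<beta> \<in> mgf_dom" "mgf \<beta> = 1" "\<And>x. x \<in> W \<Longrightarrow> r \<le> \<beta> \<bullet> x"
    and r: "r > 0" "\<And>\<epsilon>. \<epsilon> > 0 \<Longrightarrow> \<exists>x\<in>W. \<forall>\<theta>\<in>mgf_sublevel. \<theta> \<bullet> x \<le> r + \<epsilon>"
    and x0: "x0 \<in> W" "e > 0" "\<And>y. y \<in> ball x0 e \<Longrightarrow> \<exists>B. \<forall>\<theta>\<in>mgf_sublevel. \<theta> \<bullet> y \<le> B"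
    and mean: "tilted_mean 0 \<noteq> 0"
    and \<Theta>: "finite \<Theta>" "\<Theta> \<subseteq> mgf_dom"
      "\<And>\<theta> c. \<theta> \<in> \<Theta> \<Longrightarrow> \<not> (AE \<omega> in M. (\<theta> - \<beta>) \<bullet> Y \<omega> = c)"
  obtains \<eta> c x where "\<eta> \<in> mgf_dom" "mgf \<eta> = 1" "c > 0" "x = c *\<^sub>R tilted_mean \<eta>" "x \<in> W"
    "0 \<le> \<eta> \<bullet> x" "\<And>\<theta>. \<theta> \<in> \<Theta> \<Longrightarrow> \<eta> \<bullet> x + max 0 (\<theta> \<bullet> x - c * ln (mgf \<theta>)) < 2 * r"
proof -
  define gap where "gap \<theta> = (ln (mgf \<theta>) + ln (mgf \<beta>)) / 2 - ln (mgf ((1/2) *\<^sub>R (\<theta> + \<beta>)))" for \<theta>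
  have mid: "(1/2) *\<^sub>R (\<theta> + \<beta>) \<in> mgf_dom" "gap \<theta> > 0" if "\<theta> \<in> \<Theta>" for \<theta>
    using ln_mgf_midpoint[of \<theta> \<beta>] that \<Theta> \<beta>(1) by (auto simp: gap_def)
  obtain \<kappa> where \<kappa>: "\<kappa> > 0" "\<And>\<theta>. \<theta> \<in> \<Theta> \<Longrightarrow> \<kappa> \<le> gap \<theta>"
    using finite_uniform_lower_bound[of \<Theta> gap] \<Theta>(1) mid(2) by blast
  obtain a K where aK: "a > 0" "K > 0"
    and mult: "\<And>\<eta> c x. \<eta> \<in> mgf_dom \<Longrightarrow> mgf \<eta> = 1 \<Longrightarrow> c > 0 \<Longrightarrow> x = c *\<^sub>R tilted_mean \<eta> \<Longrightarrow>
      \<delta> \<le> norm x \<Longrightarrow> a \<le> c * K + (\<eta> - \<beta>) \<bullet> x"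
    using multiplier_lower_bound[OF \<beta>(1) W(2)] by metis
  \<comment> \<open>\<open>a / 2\<close> yields \<open>c \<ge> a / (2 * K)\<close>, and then the
    third entry yields \<open>2 * \<epsilon> \<le> c * \<kappa>\<close>. The cost is thus at most
    \<open>3 * (r + \<epsilon>) - r - 4 * \<epsilon> = 2 * r - \<epsilon>\<close> when the positive
    part is active; \<open>r / 4\<close> settles the case where it vanishes.\<close>
  define \<epsilon> where "\<epsilon> = min (r / 4) (min (a / 2) (a * \<kappa> / (4 * K)))"
  have \<epsilon>: "\<epsilon> > 0" "\<epsilon> \<le> r / 4" "\<epsilon> \<le> a / 2" "\<epsilon> \<le> a * \<kappa> / (4 * K)"
    unfolding \<epsilon>_def using r(1) aK \<kappa>(1) by auto
  obtain x1 where x1: "x1 \<in> W" "\<And>\<theta>. \<theta> \<in> mgf_sublevel \<Longrightarrow> \<theta> \<bullet> x1 \<le> r + \<epsilon> / 2"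
    using r(2)[of "\<epsilon> / 2"] \<epsilon>(1) by auto
  obtain B where B: "\<And>\<theta>. \<theta> \<in> mgf_sublevel \<Longrightarrow> \<theta> \<bullet> x0 \<le> B"
    using x0(3)[of x0] x0(2) by auto
  \<comment> \<open>Moving from \<open>x1\<close> towards \<open>x0\<close> by this fraction raises
    the bound on the support function by at most \<open>\<epsilon> / 2\<close>, while any positive
    fraction gives boundedness.\<close>
  define t where "t = min (1 / 2) (\<epsilon> / (2 * (\<bar>B\<bar> + 1)))"
  have t: "t > 0" "t < 1" and tB: "t * (\<bar>B\<bar> + 1) \<le> \<epsilon> / 2"
  proof -
    show "t > 0" "t < 1" using \<epsilon>(1) by (auto simp: t_def)
    have "t \<le> \<epsilon> / (2 * (\<bar>B\<bar> + 1))" by (simp add: t_def)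
    then have "t * (2 * (\<bar>B\<bar> + 1)) \<le> \<epsilon>" by (subst (asm) pos_le_divide_eq) auto
    then show "t * (\<bar>B\<bar> + 1) \<le> \<epsilon> / 2" by linarith
  qed
  define x where "x = (1 - t) *\<^sub>R x1 + t *\<^sub>R x0"
  have xW: "x \<in> W" unfolding x_def
    using W(1) x1(1) x0(1) t by (intro convexD) auto
  have xI: "\<theta> \<bullet> x \<le> r + \<epsilon>" if "\<theta> \<in> mgf_sublevel" for \<theta>
  proof -
    have "(1 - t) * (\<theta> \<bullet> x1) \<le> (1 - t) * (r + \<epsilon> / 2)" using x1(2)[OF that] t by (intro mult_left_mono) auto
    also have "\<dots> \<le> 1 * (r + \<epsilon> / 2)" using t r(1) \<epsilon>(1) by (intro mult_right_mono) auto
    finally have 1: "(1 - t) * (\<theta> \<bullet> x1) \<le> r + \<epsilon> / 2" by simp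
    have "t * (\<theta> \<bullet> x0) \<le> t * (\<bar>B\<bar> + 1)" using B[OF that] t by (intro mult_left_mono) auto
    with 1 tB show ?thesis by (simp add: x_def inner_add_right)
  qed
  have "x \<noteq> 0" using W(2) W(3)[OF xW] by auto
  obtain \<theta>0 where \<theta>0: "\<theta>0 \<in> mgf_dom" "mgf \<theta>0 < 1" using mgf_less_1_exists[OF mean] .
  have "bounded {\<theta> \<in> mgf_sublevel. 0 \<le> \<theta> \<bullet> x}"
    unfolding x_def by (rule bounded_sublevel_halfspace[OF t x1(2) x0(2,3)])
  from sublevel_maximiser[OF \<open>x \<noteq> 0\<close> this \<theta>0]
  obtain \<eta> c where \<eta>: "\<eta> \<in> mgf_dom" "mgf \<eta> = 1" and c: "c > 0" and xc: "x = c *\<^sub>R tilted_mean \<eta>"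
    and max: "\<And>\<theta>. \<theta> \<in> mgf_sublevel \<Longrightarrow> \<theta> \<bullet> x \<le> \<eta> \<bullet> x" by blast
  have \<eta>x: "0 \<le> \<eta> \<bullet> x" "\<eta> \<bullet> x \<le> r + \<epsilon>" 
    using max[OF zero_in_mgf_sublevel] xI[of \<eta>] \<eta> by (auto simp: mgf_sublevel_def)
  have \<beta>x: "r \<le> \<beta> \<bullet> x" by (rule \<beta>(3)[OF xW])
  have "a \<le> c * K + (\<eta> - \<beta>) \<bullet> x" by (rule mult[OF \<eta> c xc W(3)[OF xW]])
  then have "a / 2 \<le> c * K" using \<eta>x \<beta>x \<epsilon>(3) by (simp add: inner_diff_left)
  then have "a / (2 * K) \<le> c" using aK by (simp add: field_simps)
  then have "a / (2 * K) * \<kappa> \<le> c * \<kappa>" using \<kappa>(1) by (intro mult_right_mono) auto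
  moreover have "2 * \<epsilon> \<le> a / (2 * K) * \<kappa>" using \<epsilon>(4) by simp
  ultimately have c\<kappa>: "2 * \<epsilon> \<le> c * \<kappa>" by linarith
  have "\<eta> \<bullet> x + max 0 (\<theta> \<bullet> x - c * ln (mgf \<theta>)) < 2 * r" if "\<theta> \<in> \<Theta>" for \<theta>
  proof -
    have "c * (((1/2) *\<^sub>R (\<theta> + \<beta>) - \<eta>) \<bullet> tilted_mean \<eta>) \<le> c * ln (mgf ((1/2) *\<^sub>R (\<theta> + \<beta>)))"
      using tangent_inequality[OF \<eta> mid(1)[OF that]] c by (intro mult_left_mono) auto
    also have "\<dots> = c * (ln (mgf \<theta>) / 2) - c * gap \<theta>"
      using \<beta>(2) by (simp add: gap_def algebra_simps)
    also have "\<dots> \<le> c * (ln (mgf \<theta>) / 2) - c * \<kappa>"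
      using \<kappa>(2)[OF that] c by (intro diff_left_mono mult_left_mono) auto
    finally have "((1/2) *\<^sub>R (\<theta> + \<beta>) - \<eta>) \<bullet> x \<le> c * (ln (mgf \<theta>) / 2) - c * \<kappa>"
      by (simp add: xc)
    moreover define g where "g = c * ln (mgf \<theta>)"
    ultimately have "(\<theta> \<bullet> x + \<beta> \<bullet> x) / 2 - \<eta> \<bullet> x \<le> g / 2 - c * \<kappa>"
      by (simp add: inner_add_left inner_diff_left)
    then have "\<theta> \<bullet> x + \<beta> \<bullet> x - 2 * (\<eta> \<bullet> x) \<le> g - 2 * (c * \<kappa>)" by argo
    then have "\<eta> \<bullet> x + max 0 (\<theta> \<bullet> x - g) < 2 * r"
      using \<eta>x \<beta>x c\<kappa> \<epsilon>(1,2) r(1) by (auto simp: max_def)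
    then show ?thesis by (simp add: g_def)
  qed
  then show ?thesis using that[OF \<eta> c xc xW \<eta>x(1)] by blast
qed

end

section \<open>The tilted random walk\<close>

lemma walk_measurable:
  assumes "\<And>i. i \<ge> 1 \<Longrightarrow> X i \<in> borel_measurable M" "m \<le> n"
  shows "walk X m \<in> borel_measurable (natural_filtration M X n)"
proof -
  have "X i \<in> borel_measurable (natural_filtration M X n)" if "i \<in> {1..m}" for i
  proof (rule measurableI)
    fix A :: "(real^'b) set" assume A: "A \<in> sets borel"
    have "X i -` A \<inter> space M \<in> (\<Union>i\<in>{1..n}. {X i -` A \<inter> space M | A. A \<in> sets borel})"
      using that assms(2) A by (intro UN_I[of i]) auto
    then show "X i -` A \<inter> space (natural_filtration M X n) \<in> sets (natural_filtration M X n)"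
      unfolding natural_filtration_def by (auto simp: sets_measure_of_conv space_measure_of_conv)
  qed simp
  then have "(\<lambda>\<omega>. \<Sum>i=1..m. X i \<omega>) \<in> borel_measurable (natural_filtration M X n)"
    by (intro borel_measurable_sum)
  then show ?thesis unfolding walk_def[abs_def] .
qed

lemma space_natural_filtration: "space (natural_filtration M X n) = space M"
  unfolding natural_filtration_def by (simp add: space_measure_of_conv)

lemma sets_natural_filtration_subset:
  assumes "\<And>i. i \<ge> 1 \<Longrightarrow> X i \<in> borel_measurable M"
  shows "sets (natural_filtration M X n) \<subseteq> sets M"
proof -
  have "(\<Union>i\<in>{1..n}. {X i -` A \<inter> space M | A. A \<in> sets borel}) \<subseteq> sets M"
    using assms by (auto intro: measurable_sets)
  moreover from this have "(\<Union>i\<in>{1..n}. {X i -` A \<inter> space M | A. A \<in> sets borel}) \<subseteq> Pow (space M)"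
    using sets.sets_into_space by blast
  ultimately show ?thesis
    unfolding natural_filtration_def by (simp add: sets.sigma_sets_subset)
qed

section \<open>Hitting times and the sampling mixture\<close>

lemma hit_time_le_iff:
  "hit_time X A b \<omega> \<le> enat n \<longleftrightarrow> (\<exists>k\<le>n. walk X k \<omega> \<in> (\<lambda>x. b *\<^sub>R x) ` A)"
proof
  assume le: "hit_time X A b \<omega> \<le> enat n"
  show "\<exists>k\<le>n. walk X k \<omega> \<in> (\<lambda>x. b *\<^sub>R x) ` A"
  proof (rule ccontr)
    assume "\<not> ?thesis"
    then have "enat (Suc n) \<le> hit_time X A b \<omega>"
      unfolding hit_time_def by (intro INF_greatest) (auto simp: not_le[symmetric] Suc_le_eq)
    also note le
    finally show False by simp
  qed
next
  assume "\<exists>k\<le>n. walk X k \<omega> \<in> (\<lambda>x. b *\<^sub>R x) ` A"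
  then obtain k where k: "k \<le> n" "k \<in> {n. walk X n \<omega> \<in> (\<lambda>x. b *\<^sub>R x) ` A}" by blast
  have "hit_time X A b \<omega> \<le> enat k" unfolding hit_time_def by (rule INF_lower[OF k(2)])
  with k(1) show "hit_time X A b \<omega> \<le> enat n" by (meson enat_ord_simps(1) order_trans)
qed

lemma first_target_time_le_iff:
  assumes "J \<ge> 1"
  shows "first_target_time X J W b \<omega> \<le> t \<longleftrightarrow> (\<exists>j\<in>{1..J}. hit_time X (W j) b \<omega> \<le> t)"
  unfolding first_target_time_def using assms by (subst Min_le_iff) auto

lemma enat_eq_iff_le: "(t = enat n) \<longleftrightarrow> t \<le> enat n \<and> (\<forall>m<n. \<not> t \<le> enat m)"
  by (cases t) (auto simp: not_le le_less)

text \<open>\<open>measure_of\<close> reproduces a set function only if that is countably additive,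
  so the values of \<open>mixture\<close> have to be justified; the common sigma-algebra of the
  \<open>P \<theta>\<close> is what allows the sums to be interchanged.\<close>

lemma
  fixes M :: "'a measure"
  assumes "\<And>\<theta>. \<theta> \<in> \<Theta> \<Longrightarrow> sets (P \<theta>) = sets M"
  shows sets_mixture: "sets (mixture M P \<Theta>) = sets M"
    and emeasure_mixture: "A \<in> sets M \<Longrightarrow>
      emeasure (mixture M P \<Theta>) A = (\<Sum>\<theta>\<in>\<Theta>. emeasure (P \<theta>) A) / of_nat (card \<Theta>)"
proof -
  let ?\<mu> = "\<lambda>A. (\<Sum>\<theta>\<in>\<Theta>. emeasure (P \<theta>) A) / of_nat (card \<Theta>)"
  show "sets (mixture M P \<Theta>) = sets M"
    unfolding mixture_def by simp
  assume A: "A \<in> sets M"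
  show "emeasure (mixture M P \<Theta>) A = ?\<mu> A"
  proof (rule emeasure_measure_of[OF mixture_def])
    show "sets M \<subseteq> Pow (space M)" by (rule sets.space_closed)
    show "A \<in> sets (mixture M P \<Theta>)" using A by (simp add: mixture_def)
    show "positive (sets (mixture M P \<Theta>)) ?\<mu>" by (simp add: positive_def)
    show "countably_additive (sets (mixture M P \<Theta>)) ?\<mu>"
    proof (rule countably_additiveI)
      fix B :: "nat \<Rightarrow> 'a set"
      assume B: "range B \<subseteq> sets (mixture M P \<Theta>)" "disjoint_family B"
      then have B': "range B \<subseteq> sets M" by (simp add: mixture_def)
      have "(\<Sum>i. ?\<mu> (B i)) = (\<Sum>\<theta>\<in>\<Theta>. \<Sum>i. emeasure (P \<theta>) (B i)) / of_nat (card \<Theta>)"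
        by (simp add: suminf_sum)
      also have "(\<Sum>\<theta>\<in>\<Theta>. \<Sum>i. emeasure (P \<theta>) (B i)) = (\<Sum>\<theta>\<in>\<Theta>. emeasure (P \<theta>) (\<Union>i. B i))"
        using B' B(2) assms by (intro sum.cong refl suminf_emeasure) auto
      finally show "(\<Sum>i. ?\<mu> (B i)) = ?\<mu> (\<Union>i. B i)" .
    qed
  qed
qed

section \<open>Change of measure and concentration along the walk\<close>

locale tilted_walk = open_mgf M Y
  for M :: "'a measure" and Y :: "'a \<Rightarrow> real^'d" +
  fixes X :: "nat \<Rightarrow> 'a \<Rightarrow> real^'d" and P :: "real^'d \<Rightarrow> 'a measure"
  assumes X_1: "X 1 = Y"
    and X_measurable: "i \<ge> 1 \<Longrightarrow> X i \<in> borel_measurable M"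
    and tilted: "\<theta> \<in> mgf_dom \<Longrightarrow> is_tilted_measure M X \<theta> (P \<theta>)"
begin

lemma cgf_eq: "\<theta> \<in> mgf_dom \<Longrightarrow> cgf M X \<theta> = ereal (ln (mgf \<theta>))"
  using mgf_pos[of \<theta>] by (simp add: cgf_def X_1[simplified] nn_integral_exp elog_def)

lemma cgf_infinite: "\<theta> \<notin> mgf_dom \<Longrightarrow> cgf M X \<theta> = \<infinity>"
  by (simp add: mgf_dom_iff cgf_def X_1[simplified] elog_def less_top)

lemma cgf_le_0_iff: "cgf M X \<theta> \<le> 0 \<longleftrightarrow> \<theta> \<in> mgf_sublevel"
  using mgf_pos[of \<theta>] by (cases "\<theta> \<in> mgf_dom") (auto simp: cgf_eq cgf_infinite mgf_sublevel_def)

text \<open>The likelihood ratio of \<open>P \<theta>\<close> against \<open>M\<close> at time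
  \<open>n\<close>, with the extended \<open>cgf\<close> replaced by its real value on
  \<open>mgf_dom\<close>.\<close>

definition density :: "real^'d \<Rightarrow> nat \<Rightarrow> 'a \<Rightarrow> real" where
  "density \<theta> n \<omega> = exp (\<theta> \<bullet> walk X n \<omega> - n * ln (mgf \<theta>))"

lemma walk_measurable_F: "k \<le> n \<Longrightarrow> walk X k \<in> borel_measurable (natural_filtration M X n)"
  using X_measurable by (rule walk_measurable)

lemma walk_measurable_M [measurable]: "walk X n \<in> borel_measurable M"
  unfolding walk_def[abs_def] using X_measurable by (intro borel_measurable_sum) simp

definition at_time :: "nat \<Rightarrow> (real^'d) set \<Rightarrow> 'a set" where
  "at_time n B = {\<omega> \<in> space M. walk X n \<omega> \<in> B}"

lemma at_time_F: "k \<le> n \<Longrightarrow> B \<in> sets borel \<Longrightarrow> at_time k B \<in> sets (natural_filtration M X n)"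
proof -
  assume "k \<le> n" "B \<in> sets borel"
  then have "walk X k -` B \<inter> space (natural_filtration M X n) \<in> sets (natural_filtration M X n)"
    by (intro measurable_sets[OF walk_measurable_F])
  moreover have "walk X k -` B \<inter> space (natural_filtration M X n) = at_time k B"
    by (auto simp: at_time_def space_natural_filtration)
  ultimately show ?thesis by simp
qed

lemma F_subset: "A \<in> sets (natural_filtration M X n) \<Longrightarrow> A \<in> sets M"
  using sets_natural_filtration_subset[of X M n, OF X_measurable] by blast

lemma prob_space_P: "\<theta> \<in> mgf_dom \<Longrightarrow> prob_space (P \<theta>)"
  and sets_P: "\<theta> \<in> mgf_dom \<Longrightarrow> sets (P \<theta>) = sets M"
  using tilted by (auto simp: is_tilted_measure_def)

lemma emeasure_P:
  "\<theta> \<in> mgf_dom \<Longrightarrow> A \<in> sets (natural_filtration M X n) \<Longrightarrow>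
     emeasure (P \<theta>) A = (\<integral>\<^sup>+\<omega>. ennreal (density \<theta> n \<omega>) * indicator A \<omega> \<partial>M)"
  using tilted[of \<theta>] by (simp add: is_tilted_measure_def cgf_eq density_def)

lemma nn_integral_density:
  assumes "\<theta> \<in> mgf_dom"
  shows "(\<integral>\<^sup>+\<omega>. ennreal (density \<theta> n \<omega>) \<partial>M) = 1"
proof -
  have "space M \<in> sets (natural_filtration M X n)"
    using sets.top[of "natural_filtration M X n"] by (simp add: space_natural_filtration)
  from emeasure_P[OF assms this]
  have "emeasure (P \<theta>) (space M) = (\<integral>\<^sup>+\<omega>. ennreal (density \<theta> n \<omega>) \<partial>M)"
    by (simp cong: nn_integral_cong)
  moreover have "space M = space (P \<theta>)" using sets_eq_imp_space_eq[OF sets_P[OF assms]] by simp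
  ultimately show ?thesis using prob_space.emeasure_space_1[OF prob_space_P[OF assms]] by simp
qed

lemma emeasure_P_ge:
  assumes "\<theta> \<in> mgf_dom" "A \<in> sets (natural_filtration M X n)"
    "\<And>\<omega>. \<omega> \<in> A \<Longrightarrow> k \<le> density \<theta> n \<omega>"
  shows "ennreal k * emeasure M A \<le> emeasure (P \<theta>) A"
  unfolding emeasure_P[OF assms(1,2)] nn_integral_cmult_indicator[OF F_subset[OF assms(2)], symmetric]
  using assms(3) by (intro nn_integral_mono) (auto simp: indicator_def intro: ennreal_leI)

lemma emeasure_P_le:
  assumes "\<theta> \<in> mgf_dom" "A \<in> sets (natural_filtration M X n)"
    "\<And>\<omega>. \<omega> \<in> A \<Longrightarrow> density \<theta> n \<omega> \<le> k"
  shows "emeasure (P \<theta>) A \<le> ennreal k * emeasure M A"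
  unfolding emeasure_P[OF assms(1,2)] nn_integral_cmult_indicator[OF F_subset[OF assms(2)], symmetric]
  using assms(3) by (intro nn_integral_mono) (auto simp: indicator_def intro: ennreal_leI)

text \<open>That the density of a further tilting has total mass \<open>1\<close> replaces independence here.\<close>

lemma chernoff_walk:
  assumes \<eta>: "\<eta> \<in> mgf_dom" "mgf \<eta> = 1" and \<eta>': "\<eta> + s *\<^sub>R h \<in> mgf_dom" and s: "s > 0"
  shows "emeasure (P \<eta>) (at_time n {y. a < h \<bullet> (y - real n *\<^sub>R u)})
    \<le> ennreal (exp (n * (ln (mgf (\<eta> + s *\<^sub>R h)) - s * (h \<bullet> u)) - s * a))"
proof -
  let ?A = "at_time n {y. a < h \<bullet> (y - real n *\<^sub>R u)}"
  let ?k = "n * (ln (mgf (\<eta> + s *\<^sub>R h)) - s * (h \<bullet> u)) - s * a"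
  have "?A \<in> sets (natural_filtration M X n)"
    by (intro at_time_F) auto
  then have "emeasure (P \<eta>) ?A = (\<integral>\<^sup>+\<omega>. ennreal (density \<eta> n \<omega>) * indicator ?A \<omega> \<partial>M)"
    by (rule emeasure_P[OF \<eta>(1)])
  also have "\<dots> \<le> (\<integral>\<^sup>+\<omega>. ennreal (exp ?k) * ennreal (density (\<eta> + s *\<^sub>R h) n \<omega>) \<partial>M)"
  proof (intro nn_integral_mono)
    fix \<omega>
    show "ennreal (density \<eta> n \<omega>) * indicator ?A \<omega> \<le> ennreal (exp ?k) * ennreal (density (\<eta> + s *\<^sub>R h) n \<omega>)"
    proof (cases "\<omega> \<in> ?A")
      case True
      then have "s * a \<le> s * (h \<bullet> (walk X n \<omega> - real n *\<^sub>R u))"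
        using s by (intro mult_left_mono) (auto simp: at_time_def)
      then have "\<eta> \<bullet> walk X n \<omega> \<le> ?k + ((\<eta> + s *\<^sub>R h) \<bullet> walk X n \<omega> - n * ln (mgf (\<eta> + s *\<^sub>R h)))"
        by (simp add: inner_add_left inner_diff_right algebra_simps)
      then have "density \<eta> n \<omega> \<le> exp ?k * density (\<eta> + s *\<^sub>R h) n \<omega>"
        by (simp add: density_def \<eta>(2) flip: exp_add)
      then have "ennreal (density \<eta> n \<omega>) \<le> ennreal (exp ?k * density (\<eta> + s *\<^sub>R h) n \<omega>)"
        by (rule ennreal_leI)
      then show ?thesis using True by (simp add: ennreal_mult density_def)
    qed simp
  qed
  also have "\<dots> = ennreal (exp ?k)"
  proof -
    have "(\<lambda>\<omega>. ennreal (density (\<eta> + s *\<^sub>R h) n \<omega>)) \<in> borel_measurable M"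
      unfolding density_def by measurable
    then show ?thesis using nn_integral_density[OF \<eta>'] by (simp add: nn_integral_cmult)
  qed
  finally show ?thesis .
qed

text \<open>Union bound over times and signed coordinate directions: the number of events grows
  linearly in \<open>b\<close> and each has exponentially small mass. The level 1/2 is enough, since
  a constant factor does not affect exponential rates.\<close>

lemma walk_concentration:
  assumes \<eta>: "\<eta> \<in> mgf_dom" "mgf \<eta> = 1" and \<epsilon>: "\<epsilon> > 0" and c: "c > 0"
  shows "eventually (\<lambda>b. emeasure (P \<eta>)
      (\<Union>n\<in>{..nat \<lceil>c * b\<rceil>}. at_time n {y. \<epsilon> * b < norm (y - real n *\<^sub>R tilted_mean \<eta>)}) \<le> ennreal (1/2)) at_top"
proof -
  define V where "V = (Basis \<union> uminus ` Basis :: (real^'d) set)"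
  let ?u = "tilted_mean \<eta>"
  define d where "d = real DIM(real^'d)"
  have d: "d > 0" by (simp add: d_def)
  \<comment> \<open>Over \<open>c * b\<close> steps the slack \<open>\<epsilon>'\<close> accumulates
    to \<open>\<epsilon> * b / (2 * d)\<close>, half of the threshold
    \<open>\<epsilon> * b / d\<close> for one direction; the other half gives the decay.\<close>
  define \<epsilon>' where "\<epsilon>' = \<epsilon> / (2 * d * c)"
  have \<epsilon>': "\<epsilon>' > 0" using \<epsilon> d c by (simp add: \<epsilon>'_def)
  have "\<exists>s>0. \<eta> + s *\<^sub>R v \<in> mgf_dom \<and> ln (mgf (\<eta> + s *\<^sub>R v)) \<le> s * (v \<bullet> ?u + \<epsilon>')" for v
  proof -
    have "eventually (\<lambda>s. \<eta> + s *\<^sub>R v \<in> mgf_dom \<and> mgf (\<eta> + s *\<^sub>R v) < mgf \<eta> + s * (v \<bullet> ?u + \<epsilon>')) (at_right 0)"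
      using \<epsilon>' by (intro eventually_mgf_less \<eta>) simp
    moreover have "eventually (\<lambda>s::real. 0 < s) (at_right 0)" by (simp add: eventually_at_right_less)
    ultimately have "eventually (\<lambda>s. 0 < s \<and> \<eta> + s *\<^sub>R v \<in> mgf_dom \<and>
        mgf (\<eta> + s *\<^sub>R v) < 1 + s * (v \<bullet> ?u + \<epsilon>')) (at_right 0)"
      by eventually_elim (simp add: \<eta>)
    then obtain s where s: "0 < s" "\<eta> + s *\<^sub>R v \<in> mgf_dom" "mgf (\<eta> + s *\<^sub>R v) < 1 + s * (v \<bullet> ?u + \<epsilon>')"
      using eventually_happens'[OF trivial_limit_at_right_real] by blast
    have "ln (mgf (\<eta> + s *\<^sub>R v)) \<le> mgf (\<eta> + s *\<^sub>R v) - 1"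
      using mgf_pos[OF s(2)] by (rule ln_le_minus_one)
    with s show ?thesis by (intro exI[of _ s]) auto
  qed
  then obtain s where s: "\<And>v. s v > 0" "\<And>v. \<eta> + s v *\<^sub>R v \<in> mgf_dom"
      "\<And>v. ln (mgf (\<eta> + s v *\<^sub>R v)) \<le> s v * (v \<bullet> ?u + \<epsilon>')" by metis
  have fin: "finite V" by (simp add: V_def)
  let ?f = "\<lambda>b. \<Sum>v\<in>V. (c * b + 2) * exp (s v * \<epsilon>' - (s v * \<epsilon> / (2 * d)) * b)"
  have le: "emeasure (P \<eta>) (\<Union>n\<in>{..nat \<lceil>c * b\<rceil>}. at_time n {y. \<epsilon> * b < norm (y - real n *\<^sub>R ?u)})
      \<le> ennreal (?f b)" if b: "b > 0" for b
  proof -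
    let ?B = "\<lambda>n v. at_time n {y. \<epsilon> * b / d < v \<bullet> (y - real n *\<^sub>R ?u)}"
    let ?N = "nat \<lceil>c * b\<rceil>"
    have BM: "?B n v \<in> sets (P \<eta>)" for n v
      unfolding sets_P[OF \<eta>(1)] by (rule F_subset, rule at_time_F[OF order_refl]) simp
    have "(\<Union>n\<in>{..?N}. at_time n {y. \<epsilon> * b < norm (y - real n *\<^sub>R ?u)}) \<subseteq> (\<Union>n\<in>{..?N}. \<Union>v\<in>V. ?B n v)"
    proof (intro UN_mono subset_refl subsetI)
      fix n \<omega> assume w: "\<omega> \<in> at_time n {y. \<epsilon> * b < norm (y - real n *\<^sub>R ?u)}"
      obtain v where v: "v \<in> V" "norm (walk X n \<omega> - real n *\<^sub>R ?u) \<le> d * (v \<bullet> (walk X n \<omega> - real n *\<^sub>R ?u))"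
        using norm_le_DIM_signed_coordinate[of "walk X n \<omega> - real n *\<^sub>R ?u"] unfolding d_def V_def by blast
      then have "\<epsilon> * b < d * (v \<bullet> (walk X n \<omega> - real n *\<^sub>R ?u))" using w by (simp add: at_time_def)
      then have "\<epsilon> * b / d < v \<bullet> (walk X n \<omega> - real n *\<^sub>R ?u)" using d by (simp add: field_simps)
      then have "\<omega> \<in> ?B n v" using w by (simp add: at_time_def)
      then show "\<omega> \<in> (\<Union>v\<in>V. ?B n v)" using v(1) by blast
    qed
    then have "emeasure (P \<eta>) (\<Union>n\<in>{..?N}. at_time n {y. \<epsilon> * b < norm (y - real n *\<^sub>R ?u)})
        \<le> emeasure (P \<eta>) (\<Union>n\<in>{..?N}. \<Union>v\<in>V. ?B n v)"
      using BM fin by (intro emeasure_mono sets.finite_UN) auto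
    also have "\<dots> \<le> (\<Sum>n\<in>{..?N}. emeasure (P \<eta>) (\<Union>v\<in>V. ?B n v))"
      using BM fin by (intro emeasure_subadditive_finite image_subsetI sets.finite_UN) auto
    also have "\<dots> \<le> (\<Sum>n\<in>{..?N}. \<Sum>v\<in>V. emeasure (P \<eta>) (?B n v))"
      using BM fin by (intro sum_mono emeasure_subadditive_finite) auto
    also have "\<dots> \<le> (\<Sum>n\<in>{..?N}. \<Sum>v\<in>V. ennreal (exp (s v * \<epsilon>' - (s v * \<epsilon> / (2 * d)) * b)))"
    proof (intro sum_mono)
      fix n v assume n: "n \<in> {..?N}"
      have "real n \<le> c * b + 1"
      proof -
        have "real n \<le> real ?N" using n by simp
        also have "\<dots> \<le> c * b + 1" using b c by simp
        finally show ?thesis .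
      qed
      then have n': "real n * (s v * \<epsilon>') \<le> (c * b + 1) * (s v * \<epsilon>')"
        using \<epsilon>' s(1)[of v] by (intro mult_right_mono) auto
      have "n * (ln (mgf (\<eta> + s v *\<^sub>R v)) - s v * (v \<bullet> ?u)) \<le> n * (s v * \<epsilon>')"
        using s(3)[of v] by (intro mult_left_mono) (auto simp: algebra_simps)
      also note n'
      also have "(c * b + 1) * (s v * \<epsilon>') - s v * (\<epsilon> * b / d) = s v * \<epsilon>' - (s v * \<epsilon> / (2 * d)) * b"
        using c d by (simp add: \<epsilon>'_def field_simps)
      then have "(c * b + 1) * (s v * \<epsilon>') = s v * \<epsilon>' - (s v * \<epsilon> / (2 * d)) * b + s v * (\<epsilon> * b / d)" by linarith
      finally have "n * (ln (mgf (\<eta> + s v *\<^sub>R v)) - s v * (v \<bullet> ?u)) - s v * (\<epsilon> * b / d)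
          \<le> s v * \<epsilon>' - (s v * \<epsilon> / (2 * d)) * b" by linarith
      then show "emeasure (P \<eta>) (?B n v) \<le> ennreal (exp (s v * \<epsilon>' - (s v * \<epsilon> / (2 * d)) * b))"
        by (intro order_trans[OF chernoff_walk[OF \<eta> s(2,1)]] ennreal_leI) simp
    qed
    also have "\<dots> = ennreal ((real ?N + 1) * (\<Sum>v\<in>V. exp (s v * \<epsilon>' - (s v * \<epsilon> / (2 * d)) * b)))"
      by (simp add: sum_nonneg ennreal_mult ennreal_of_nat_eq_real_of_nat add.commute flip: ennreal_plus)
    also have "\<dots> \<le> ennreal (?f b)"
    proof (rule ennreal_leI)
      have "real ?N \<le> c * b + 1" using b c by simp
      then have "real ?N + 1 \<le> c * b + 2" by linarith
      then show "(real ?N + 1) * (\<Sum>v\<in>V. exp (s v * \<epsilon>' - (s v * \<epsilon> / (2 * d)) * b)) \<le> ?f b"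
        unfolding sum_distrib_left[symmetric] by (intro mult_right_mono sum_nonneg) auto
    qed
    finally show ?thesis .
  qed
  have "((\<lambda>b. (c * b + 2) * exp (s v * \<epsilon>' - (s v * \<epsilon> / (2 * d)) * b)) \<longlongrightarrow> 0) at_top" for v
  proof -
    define k where "k = s v * \<epsilon> / (2 * d)"
    have k: "k > 0" using s(1)[of v] \<epsilon> d by (simp add: k_def)
    have "((\<lambda>b::real. (c * b + 2) * exp (s v * \<epsilon>' - k * b)) \<longlongrightarrow> 0) at_top"
      using k c by real_asymp
    then show ?thesis unfolding k_def .
  qed
  then have "(?f \<longlongrightarrow> (\<Sum>v\<in>V. 0)) at_top" by (rule tendsto_sum)
  then have "eventually (\<lambda>b. ?f b < 1 / 2) at_top"
    by (rule order_tendstoD) simp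
  with eventually_gt_at_top[of 0] show ?thesis
  proof eventually_elim
    case (elim b)
    show ?case by (rule order_trans[OF le[OF elim(1)] ennreal_leI]) (use elim in simp)
  qed
qed

section \<open>Hitting events and their probabilities\<close>

lemma scaled_image_iff: "b > 0 \<Longrightarrow> (y :: real^'d) \<in> (\<lambda>x. b *\<^sub>R x) ` A \<longleftrightarrow> (1 / b) *\<^sub>R y \<in> A"
proof -
  assume "b > 0"
  then have "y = b *\<^sub>R x \<longleftrightarrow> x = (1 / b) *\<^sub>R y" for x by auto
  then show ?thesis by (auto simp: image_iff)
qed

lemma hit_time_eq_iff:
  "hit_time X A b \<omega> = enat n \<longleftrightarrow>
     walk X n \<omega> \<in> (\<lambda>x. b *\<^sub>R x) ` A \<and> (\<forall>k<n. walk X k \<omega> \<notin> (\<lambda>x. b *\<^sub>R x) ` A)"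
  proof -
  have "(\<exists>k\<le>n. Q k) \<and> (\<forall>m<n. \<not> (\<exists>k\<le>m. Q k)) \<longleftrightarrow> Q n \<and> (\<forall>k<n. \<not> Q k)" for Q
    by (auto simp: le_less dest: less_trans)
  then show ?thesis unfolding enat_eq_iff_le hit_time_le_iff .
qed

text \<open>The success event is split by the value of the first target time because the tilted
  measures are described only on the filtration: each piece is known at its own time
  \<open>n\<close>.\<close>

definition hit_event :: "nat \<Rightarrow> (nat \<Rightarrow> (real^'d) set) \<Rightarrow> real \<Rightarrow> nat \<Rightarrow> 'a set" where
  "hit_event J W b n = {\<omega> \<in> space M. first_target_time X J W b \<omega> = enat n \<and> enat n < hit_time X (W 0) b \<omega>}"

lemma hit_event_F:
  assumes "J \<ge> 1" "b > 0" "\<And>j. j \<le> J \<Longrightarrow> open (W j)"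
  shows "hit_event J W b n \<in> sets (natural_filtration M X n)"
proof -
  let ?W = "\<lambda>j. (\<lambda>x. b *\<^sub>R x) ` W j"
  have B: "?W j \<in> sets borel" if "j \<le> J" for j
    using assms(2,3) that by (intro borel_open open_scaling) auto
  have eq: "hit_event J W b n = ((\<Union>j\<in>{1..J}. \<Union>k\<in>{..n}. at_time k (?W j))
      - (\<Union>j\<in>{1..J}. \<Union>k\<in>{..<n}. at_time k (?W j))) - (\<Union>k\<in>{..n}. at_time k (?W 0))"
    unfolding hit_event_def enat_eq_iff_le not_le[symmetric] first_target_time_le_iff[OF assms(1)]
      hit_time_le_iff at_time_def
    by (auto 0 4 simp: not_le)
  show ?thesis unfolding eq
    by (intro sets.Diff sets.finite_UN at_time_F B) auto
qed

text \<open>Lundberg's bound: at the first entry into the scaled set the likelihood ratio of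
  \<open>P \<beta>\<close> is at least \<open>exp (r * b)\<close>, and the masses of the disjoint
  entry events under \<open>P \<beta>\<close> add up to at most 1.\<close>

lemma emeasure_hit_time_finite:
  assumes \<beta>: "\<beta> \<in> mgf_dom" "mgf \<beta> = 1" "\<And>x. x \<in> A \<Longrightarrow> r \<le> \<beta> \<bullet> x" and A: "open A" and b: "b > 0"
  shows "{\<omega> \<in> space M. hit_time X A b \<omega> < \<infinity>} \<in> sets M"
    and "emeasure M {\<omega> \<in> space M. hit_time X A b \<omega> < \<infinity>} \<le> ennreal (exp (- (r * b)))"
proof -
  let ?A = "(\<lambda>x. b *\<^sub>R x) ` A"
  define E where "E n = {\<omega> \<in> space M. hit_time X A b \<omega> = enat n}" for n
  have "open ?A" using A b by (intro open_scaling) auto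
  then have B: "?A \<in> sets borel" by (rule borel_open)
  have eq: "E n = at_time n ?A - (\<Union>k\<in>{..<n}. at_time k ?A)" for n
    unfolding E_def hit_time_eq_iff at_time_def by auto
  have EF: "E n \<in> sets (natural_filtration M X n)" for n
    unfolding eq using B by (intro sets.Diff sets.finite_UN at_time_F) auto
  have EM: "E n \<in> sets M" for n using EF by (rule F_subset)
  have U: "{\<omega> \<in> space M. hit_time X A b \<omega> < \<infinity>} = (\<Union>n. E n)"
    by (auto simp: E_def less_infinityE elim: less_infinityE)
  have disj: "disjoint_family E" by (auto simp: disjoint_family_on_def E_def)
  show "{\<omega> \<in> space M. hit_time X A b \<omega> < \<infinity>} \<in> sets M" unfolding U using EM by auto
  have "ennreal (exp (r * b)) * emeasure M (E n) \<le> emeasure (P \<beta>) (E n)" for n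
  proof (rule emeasure_P_ge[OF \<beta>(1) EF])
    fix \<omega> assume "\<omega> \<in> E n"
    then obtain x where "x \<in> A" "walk X n \<omega> = b *\<^sub>R x" by (auto simp: eq at_time_def)
    then show "exp (r * b) \<le> density \<beta> n \<omega>"
      using \<beta>(3)[of x] b by (simp add: density_def \<beta>(2) mult.commute)
  qed
  then have "(\<Sum>n. ennreal (exp (r * b)) * emeasure M (E n)) \<le> (\<Sum>n. emeasure (P \<beta>) (E n))"
    by (intro suminf_le) auto
  also have "\<dots> = emeasure (P \<beta>) (\<Union>n. E n)"
    using EM disj by (intro suminf_emeasure) (auto simp: sets_P[OF \<beta>(1)])
  also have "\<dots> \<le> 1" using prob_space.measure_le_1 prob_space.emeasure_le_1[OF prob_space_P[OF \<beta>(1)]] by blast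
  also have "(\<Sum>n. ennreal (exp (r * b)) * emeasure M (E n)) = ennreal (exp (r * b)) * emeasure M (\<Union>n. E n)"
    using EM disj by (simp add: suminf_emeasure image_subset_iff)
  finally have "ennreal (exp (- (r * b))) * (ennreal (exp (r * b)) * emeasure M (\<Union>n. E n)) \<le> ennreal (exp (- (r * b))) * 1"
    by (rule mult_left_mono) simp
  then show "emeasure M {\<omega> \<in> space M. hit_time X A b \<omega> < \<infinity>} \<le> ennreal (exp (- (r * b)))"
    unfolding U by (simp flip: mult.assoc ennreal_mult exp_add)
qed

text \<open>An upper bound suffices for inefficiency: it keeps the negative denominator of the log
  ratio away from 0, while the numerator is bounded below. Success forces some target to be hit in
  finite time.\<close>

lemma hit_probability_upper_bound:
  assumes "J \<ge> 1" "b > 0" "\<And>j. j \<in> {1..J} \<Longrightarrow> open (W j)"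
    and "\<And>j. j \<in> {1..J} \<Longrightarrow> \<beta> j \<in> mgf_dom \<and> mgf (\<beta> j) = 1"
    and "\<And>j x. j \<in> {1..J} \<Longrightarrow> x \<in> W j \<Longrightarrow> r \<le> \<beta> j \<bullet> x"
  shows "emeasure M {\<omega> \<in> space M. first_target_time X J W b \<omega> < hit_time X (W 0) b \<omega>}
    \<le> ennreal (J * exp (- (r * b)))"
proof -
  let ?H = "\<lambda>j. {\<omega> \<in> space M. hit_time X (W j) b \<omega> < \<infinity>}"
  have H: "?H j \<in> sets M" "emeasure M (?H j) \<le> ennreal (exp (- (r * b)))" if "j \<in> {1..J}" for j
    using emeasure_hit_time_finite[of "\<beta> j" "W j" r b] assms that by blast+
  have "{\<omega> \<in> space M. first_target_time X J W b \<omega> < hit_time X (W 0) b \<omega>} \<subseteq> (\<Union>j\<in>{1..J}. ?H j)"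
  proof
    fix \<omega> assume "\<omega> \<in> {\<omega> \<in> space M. first_target_time X J W b \<omega> < hit_time X (W 0) b \<omega>}"
    then have w: "\<omega> \<in> space M" "first_target_time X J W b \<omega> < hit_time X (W 0) b \<omega>" by auto
    then obtain n where "first_target_time X J W b \<omega> = enat n"
      by (cases "first_target_time X J W b \<omega>") auto
    then obtain j where "j \<in> {1..J}" "hit_time X (W j) b \<omega> \<le> enat n"
      using first_target_time_le_iff[OF assms(1), of X W b \<omega> "enat n"] by auto
    then have "hit_time X (W j) b \<omega> < \<infinity>" by (cases "hit_time X (W j) b \<omega>") auto
    then show "\<omega> \<in> (\<Union>j\<in>{1..J}. ?H j)" using w(1) \<open>j \<in> {1..J}\<close> by blast
  qed
  then have "emeasure M {\<omega> \<in> space M. first_target_time X J W b \<omega> < hit_time X (W 0) b \<omega>}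
      \<le> emeasure M (\<Union>j\<in>{1..J}. ?H j)"
    using H(1) by (intro emeasure_mono sets.finite_UN) auto
  also have "\<dots> \<le> (\<Sum>j\<in>{1..J}. emeasure M (?H j))"
    using H(1) by (intro emeasure_subadditive_finite) auto
  also have "\<dots> \<le> (\<Sum>j\<in>{1..J}. ennreal (exp (- (r * b))))"
    by (intro sum_mono H(2))
  also have "\<dots> = ennreal (J * exp (- (r * b)))"
    by (simp add: ennreal_mult ennreal_of_nat_eq_real_of_nat)
  finally show ?thesis .
qed

text \<open>A pathwise statement. Of the radius \<open>\<rho>\<close>, one half covers rounding
  \<open>c * b\<close> up to an integer and the other the fluctuation \<open>\<epsilon>\<close>. The
  rounding overshoots the segment from 0 to \<open>x\<close>, and \<open>c * b \<ge> 1\<close> keeps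
  the overshoot within \<open>t \<le> 2\<close>. The first target hit may be another one, and
  earlier, so only some \<open>n\<close> is claimed.\<close>

lemma near_line_path_hits:
  assumes x: "x = c *\<^sub>R u" and c: "c > 0" and b: "b > 0" "c * b \<ge> 1" "2 * norm u < b * \<rho>"
    and \<epsilon>: "2 * \<epsilon> < \<rho>" and J: "J \<ge> 1" "j \<in> {1..J}" and W: "ball x \<rho> \<subseteq> W j"
    and sep: "\<And>t y. 0 \<le> t \<Longrightarrow> t \<le> 2 \<Longrightarrow> y \<in> W 0 \<Longrightarrow> \<rho> \<le> dist (t *\<^sub>R x) y"
    and path: "\<And>n. n \<le> nat \<lceil>c * b\<rceil> \<Longrightarrow> norm (walk X n \<omega> - real n *\<^sub>R u) \<le> \<epsilon> * b" and \<omega>: "\<omega> \<in> space M"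
  shows "\<exists>n\<le>nat \<lceil>c * b\<rceil>. \<omega> \<in> hit_event J W b n"
proof -
  define N where "N = nat \<lceil>c * b\<rceil>"
  have cb: "c * b > 0" using c b by simp
  have N: "c * b \<le> real N" "real N \<le> c * b + 1"
    using cb by (simp_all add: N_def)
  have close: "norm ((1 / b) *\<^sub>R walk X n \<omega> - (n / b) *\<^sub>R u) \<le> \<epsilon>" if "n \<le> N" for n
  proof -
    have "(1 / b) *\<^sub>R walk X n \<omega> - (n / b) *\<^sub>R u = (1 / b) *\<^sub>R (walk X n \<omega> - real n *\<^sub>R u)"
      by (simp add: scaleR_diff_right)
    then have "norm ((1 / b) *\<^sub>R walk X n \<omega> - (n / b) *\<^sub>R u) = norm (walk X n \<omega> - real n *\<^sub>R u) / b"
      using b by simp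
    then show ?thesis using path[OF that[unfolded N_def]] b by (simp add: divide_le_eq)
  qed
  have "norm ((N / b) *\<^sub>R u - x) = \<bar>N / b - c\<bar> * norm u"
    by (simp add: x flip: scaleR_diff_left)
  also have "\<dots> \<le> 1 / b * norm u"
  proof (rule mult_right_mono)
    have "N / b - c = (N - c * b) / b" using b by (simp add: field_simps)
    moreover have "\<bar>N - c * b\<bar> \<le> 1" using N by linarith
    ultimately show "\<bar>N / b - c\<bar> \<le> 1 / b" using b by (simp add: divide_right_mono)
  qed simp
  finally have "2 * norm ((N / b) *\<^sub>R u - x) \<le> 2 * norm u / b" by simp
  also have "\<dots> < \<rho>" using b by (simp add: pos_divide_less_eq mult.commute)
  finally have "2 * norm ((N / b) *\<^sub>R u - x) < \<rho>" by simp
  then have "dist x ((1 / b) *\<^sub>R walk X N \<omega>) < \<rho>"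
    using close[of N] \<epsilon> norm_triangle_ineq[of "(1 / b) *\<^sub>R walk X N \<omega> - (N / b) *\<^sub>R u" "(N / b) *\<^sub>R u - x"]
    by (simp add: dist_norm norm_minus_commute)
  then have "(1 / b) *\<^sub>R walk X N \<omega> \<in> W j" using W by auto
  then have "hit_time X (W j) b \<omega> \<le> enat N"
    unfolding hit_time_le_iff scaled_image_iff[OF b(1)] by blast
  then have "first_target_time X J W b \<omega> \<le> enat N"
    unfolding first_target_time_le_iff[OF J(1)] using J(2) by blast
  then obtain n where n: "first_target_time X J W b \<omega> = enat n" "n \<le> N"
    by (cases "first_target_time X J W b \<omega>") auto
  have "\<not> hit_time X (W 0) b \<omega> \<le> enat N"
    unfolding hit_time_le_iff scaled_image_iff[OF b(1)]
  proof (intro notI, elim exE conjE)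
    fix k assume k: "k \<le> N" "(1 / b) *\<^sub>R walk X k \<omega> \<in> W 0"
    have "real k \<le> c * b + 1" using k(1) N(2) by linarith
    then have "real k \<le> 2 * (c * b)" using b(2) by linarith
    then have "real k / (c * b) \<le> 2" using cb by (simp add: pos_divide_le_eq)
    from sep[OF _ this k(2)] have "\<rho> \<le> dist ((k / b) *\<^sub>R u) ((1 / b) *\<^sub>R walk X k \<omega>)"
      using cb c by (simp add: x)
    then have "\<rho> \<le> \<epsilon>" using close[OF k(1)] by (simp add: dist_norm norm_minus_commute)
    moreover have "0 \<le> \<epsilon>" using order_trans[OF norm_ge_zero path[OF k(1)[unfolded N_def]]] b by (simp add: zero_le_mult_iff)
    ultimately show False using \<epsilon> by linarith
  qed
  then have "enat n < hit_time X (W 0) b \<omega>" using n(2) by (meson enat_ord_simps(1) not_le order_trans)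
  with n \<omega> show ?thesis unfolding hit_event_def N_def by blast
qed

subsection \<open>Lower bound for the second moment\<close>

lemma estimator_on_hit_event:
  assumes "\<omega> \<in> hit_event J W b n" "\<Theta> \<subseteq> mgf_dom"
  shows "sampling_estimator M X J W \<Theta> b \<omega> = inverse ((1 / card \<Theta>) * (\<Sum>\<theta>\<in>\<Theta>. density \<theta> n \<omega>))"
proof -
  have "first_target_time X J W b \<omega> = enat n" "enat n < hit_time X (W 0) b \<omega>"
    using assms(1) by (auto simp: hit_event_def)
  moreover have "likelihood_ratio M X \<theta> (first_target_time X J W b) \<omega> = density \<theta> n \<omega>" if "\<theta> \<in> \<Theta>" for \<theta>
    using that assms(2) calculation(1) by (auto simp: likelihood_ratio_def density_def cgf_eq)
  ultimately show ?thesis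
    unfolding sampling_estimator_def by (simp cong: sum.cong)
qed

lemma density_bounds:
  assumes "norm (walk X n \<omega> - real n *\<^sub>R u) \<le> a" "norm \<theta> \<le> R"
  shows "exp (n * (\<theta> \<bullet> u - ln (mgf \<theta>))) / exp (R * a) \<le> density \<theta> n \<omega>"
    and "density \<theta> n \<omega> \<le> exp (n * (\<theta> \<bullet> u - ln (mgf \<theta>))) * exp (R * a)"
proof -
  have "\<bar>\<theta> \<bullet> (walk X n \<omega> - real n *\<^sub>R u)\<bar> \<le> norm \<theta> * norm (walk X n \<omega> - real n *\<^sub>R u)"
    by (rule Cauchy_Schwarz_ineq2)
  also have "\<dots> \<le> R * a"
    using assms order_trans[OF norm_ge_zero assms(2)] by (intro mult_mono) auto
  finally have *: "\<bar>\<theta> \<bullet> walk X n \<omega> - n * (\<theta> \<bullet> u)\<bar> \<le> R * a" by (simp add: inner_diff_right)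
  show "exp (n * (\<theta> \<bullet> u - ln (mgf \<theta>))) / exp (R * a) \<le> density \<theta> n \<omega>"
    using * by (simp add: density_def right_diff_distrib flip: exp_diff)
  show "density \<theta> n \<omega> \<le> exp (n * (\<theta> \<bullet> u - ln (mgf \<theta>))) * exp (R * a)"
    using * by (simp add: density_def right_diff_distrib flip: exp_add)
qed

text \<open>On the part of \<open>hit_event J W b n\<close> where the walk is close to \<open>n *\<^sub>R tilted_mean \<eta>\<close>, all likelihood
  ratios are deterministic up to the factor \<open>exp (R * a)\<close>. The estimator is thus nearly constant
  there and only the masses of this event under the various tiltings have to be compared.\<close>

lemma near_line_contribution:
  assumes \<eta>: "\<eta> \<in> mgf_dom" "mgf \<eta> = 1" and \<Theta>: "\<Theta> \<subseteq> mgf_dom" "finite \<Theta>" "\<Theta> \<noteq> {}"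
    and R: "norm \<eta> \<le> R" "\<And>\<theta>. \<theta> \<in> \<Theta> \<Longrightarrow> norm \<theta> \<le> R"
    and C: "C \<in> sets (natural_filtration M X n)" "C \<subseteq> hit_event J W b n"
      "\<And>\<omega>. \<omega> \<in> C \<Longrightarrow> norm (walk X n \<omega> - real n *\<^sub>R tilted_mean \<eta>) \<le> a"
    and \<kappa>: "\<And>\<theta>. \<theta> \<in> \<Theta> \<Longrightarrow> n * (\<eta> \<bullet> tilted_mean \<eta>) + n * (\<theta> \<bullet> tilted_mean \<eta> - ln (mgf \<theta>)) \<le> \<kappa>"
  obtains k where "k \<ge> 0" "\<And>\<omega>. \<omega> \<in> C \<Longrightarrow> k \<le> (sampling_estimator M X J W \<Theta> b \<omega>)\<^sup>2"
    "ennreal (exp (- \<kappa> - 4 * (R * a))) * emeasure (P \<eta>) C \<le> ennreal k * emeasure (mixture M P \<Theta>) C"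
proof -
  let ?u = "tilted_mean \<eta>"
  define E where "E = exp (R * a)"
  have E: "E > 0" by (simp add: E_def)
  define e where "e \<theta> = exp (n * (\<theta> \<bullet> ?u - ln (mgf \<theta>)))" for \<theta>
  define m where "m = real (card \<Theta>)"
  have m: "m > 0" using \<Theta> by (simp add: m_def card_gt_0_iff)
  \<comment> \<open>To leading order the estimator equals \<open>1 / d\<close> on \<open>C\<close>
    and the mixture gives \<open>C\<close> the mass \<open>d * emeasure M C\<close>, so the
    contribution is \<open>emeasure M C / d\<close>.\<close>
  define d where "d = (\<Sum>\<theta>\<in>\<Theta>. e \<theta>) / m"
  have d: "d > 0" unfolding d_def using \<Theta> m by (intro divide_pos_pos sum_pos) (auto simp: e_def)
  define k where "k = (inverse (d * E))\<^sup>2"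
  have CM: "C \<in> sets M" using C(1) by (rule F_subset)
  have 1: "k \<le> (sampling_estimator M X J W \<Theta> b \<omega>)\<^sup>2" if w: "\<omega> \<in> C" for \<omega>
  proof -
    have "(\<Sum>\<theta>\<in>\<Theta>. density \<theta> n \<omega>) \<le> (\<Sum>\<theta>\<in>\<Theta>. e \<theta> * E)"
      unfolding e_def E_def using density_bounds(2)[OF C(3)[OF w] R(2)] by (intro sum_mono)
    then have "(1 / m) * (\<Sum>\<theta>\<in>\<Theta>. density \<theta> n \<omega>) \<le> (1 / m) * (\<Sum>\<theta>\<in>\<Theta>. e \<theta> * E)"
      using m by (intro mult_left_mono) auto
    also have "\<dots> = d * E" by (simp add: d_def flip: sum_distrib_right)
    finally have le: "(1 / m) * (\<Sum>\<theta>\<in>\<Theta>. density \<theta> n \<omega>) \<le> d * E" .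
    have "0 < (1 / m) * (\<Sum>\<theta>\<in>\<Theta>. density \<theta> n \<omega>)"
      using \<Theta> m by (intro mult_pos_pos sum_pos) (auto simp: density_def)
    from le_imp_inverse_le[OF le this] have "inverse (d * E) \<le> sampling_estimator M X J W \<Theta> b \<omega>"
      using estimator_on_hit_event[OF subsetD[OF C(2) w] \<Theta>(1)] by (simp add: m_def)
    then show ?thesis unfolding k_def using d E by (intro power_mono) auto
  qed
  have mix: "ennreal (d / E) * emeasure M C \<le> emeasure (mixture M P \<Theta>) C"
  proof -
    have "ennreal (d / E) * emeasure M C = (\<Sum>\<theta>\<in>\<Theta>. ennreal (e \<theta> / E) * emeasure M C) / of_nat (card \<Theta>)"
    proof -
      have "d / E = (\<Sum>\<theta>\<in>\<Theta>. e \<theta> / E) / m" by (simp add: d_def divide_divide_eq_left mult.commute flip: sum_divide_distrib)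
      moreover have "(\<Sum>\<theta>\<in>\<Theta>. ennreal (e \<theta> / E)) = ennreal (\<Sum>\<theta>\<in>\<Theta>. e \<theta> / E)"
        using E by (intro sum_ennreal) (simp add: e_def)
      moreover have "0 \<le> (\<Sum>\<theta>\<in>\<Theta>. e \<theta> / E)"
        using E by (intro sum_nonneg) (simp add: e_def)
      ultimately have "ennreal (d / E) = (\<Sum>\<theta>\<in>\<Theta>. ennreal (e \<theta> / E)) / of_nat (card \<Theta>)"
        using m by (simp add: divide_ennreal m_def ennreal_of_nat_eq_real_of_nat)
      then show ?thesis by (simp add: divide_ennreal_def mult_ac flip: sum_distrib_right sum_distrib_left)
    qed
    also have "\<dots> \<le> (\<Sum>\<theta>\<in>\<Theta>. emeasure (P \<theta>) C) / of_nat (card \<Theta>)"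
    proof (intro divide_right_mono_ennreal sum_mono)
      fix \<theta> assume "\<theta> \<in> \<Theta>"
      then show "ennreal (e \<theta> / E) * emeasure M C \<le> emeasure (P \<theta>) C"
        using \<Theta>(1) density_bounds(1)[OF C(3) R(2)] unfolding e_def E_def
        by (intro emeasure_P_ge[OF _ C(1)]) auto
    qed
    also have "\<dots> = emeasure (mixture M P \<Theta>) C"
      by (rule emeasure_mixture[symmetric, OF _ CM]) (use \<Theta>(1) sets_P in blast)
    finally show ?thesis .
  qed
  have P\<eta>: "emeasure (P \<eta>) C \<le> ennreal (exp (n * (\<eta> \<bullet> ?u)) * E) * emeasure M C"
    using density_bounds(2)[OF C(3) R(1)] \<eta> unfolding E_def
    by (intro emeasure_P_le[OF _ C(1)]) auto
  have "d * exp (n * (\<eta> \<bullet> ?u)) \<le> exp \<kappa>"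
  proof -
    have "(\<Sum>\<theta>\<in>\<Theta>. e \<theta> * exp (n * (\<eta> \<bullet> ?u))) \<le> (\<Sum>\<theta>\<in>\<Theta>. exp \<kappa>)"
      using \<kappa> by (intro sum_mono) (simp add: e_def add.commute flip: exp_add)
    then have "(\<Sum>\<theta>\<in>\<Theta>. e \<theta>) * exp (n * (\<eta> \<bullet> ?u)) \<le> m * exp \<kappa>"
      by (simp add: m_def sum_distrib_right)
    then show ?thesis using m by (simp add: d_def field_simps)
  qed
  then have "exp (- \<kappa>) * (d * exp (n * (\<eta> \<bullet> ?u))) \<le> exp (- \<kappa>) * exp \<kappa>"
    by (intro mult_left_mono) auto
  then have kap: "exp (- \<kappa>) * d * exp (n * (\<eta> \<bullet> ?u)) \<le> 1" by (simp flip: exp_add)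
  \<comment> \<open>The four factors \<open>E\<close> arise as two from the squared estimator, one
    from the mass under the mixture and one from comparing \<open>P \<eta>\<close> with
    \<open>M\<close>.\<close>
  have key: "exp (- \<kappa> - 4 * (R * a)) * (exp (n * (\<eta> \<bullet> ?u)) * E) \<le> k * (d / E)"
  proof -
    have "exp (4 * (R * a)) = E ^ 4" unfolding E_def by (simp flip: exp_of_nat_mult)
    then have "exp (- \<kappa> - 4 * (R * a)) = exp (- \<kappa>) / E ^ 4"
      by (simp add: exp_diff)
    then have "exp (- \<kappa> - 4 * (R * a)) * (exp (n * (\<eta> \<bullet> ?u)) * E)
        = (exp (- \<kappa>) * d * exp (n * (\<eta> \<bullet> ?u))) * (1 / (d * E ^ 3))"
      using E d by (simp add: field_simps eval_nat_numeral)
    also have "\<dots> \<le> 1 * (1 / (d * E ^ 3))"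
      using kap E d by (intro mult_right_mono) auto
    also have "\<dots> = k * (d / E)"
      using E d by (simp add: k_def field_simps eval_nat_numeral)
    finally show ?thesis .
  qed
  have "ennreal (exp (- \<kappa> - 4 * (R * a))) * emeasure (P \<eta>) C
      \<le> ennreal (exp (- \<kappa> - 4 * (R * a))) * (ennreal (exp (n * (\<eta> \<bullet> ?u)) * E) * emeasure M C)"
    by (intro mult_left_mono P\<eta>) simp
  also have "\<dots> = ennreal (exp (- \<kappa> - 4 * (R * a)) * (exp (n * (\<eta> \<bullet> ?u)) * E)) * emeasure M C"
    using E by (simp add: ennreal_mult mult.assoc)
  also have "\<dots> \<le> ennreal (k * (d / E)) * emeasure M C"
    by (intro mult_right_mono ennreal_leI key) simp
  also have "\<dots> = ennreal k * (ennreal (d / E) * emeasure M C)"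
    using E d by (subst ennreal_mult) (auto simp: k_def mult.assoc)
  also have "\<dots> \<le> ennreal k * emeasure (mixture M P \<Theta>) C"
    by (intro mult_left_mono mix) simp
  finally have 2: "ennreal (exp (- \<kappa> - 4 * (R * a))) * emeasure (P \<eta>) C \<le> ennreal k * emeasure (mixture M P \<Theta>) C" .
  show ?thesis by (rule that[of k]) (use 1 2 in \<open>auto simp: k_def\<close>)
qed

text \<open>No single hitting time need carry a fixed share of the mass. The pieces
  \<open>C n\<close> are disjoint, as the first target time has one value, so their contributions
  add up, and together they carry at least half of the mass of \<open>P \<eta>\<close>.\<close>

lemma second_moment_lower_bound:
  assumes J: "J \<ge> 1" "j \<in> {1..J}" and W: "\<And>i. i \<le> J \<Longrightarrow> open (W i)"
    and \<eta>: "\<eta> \<in> mgf_dom" "mgf \<eta> = 1" and c: "c > 0" and x: "x = c *\<^sub>R tilted_mean \<eta>" "x \<in> W j"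
    and sep: "\<And>t. 0 \<le> t \<Longrightarrow> t \<le> 2 \<Longrightarrow> t *\<^sub>R x \<notin> closure (W 0)"
    and \<Theta>: "\<Theta> \<subseteq> mgf_dom" "finite \<Theta>" "\<Theta> \<noteq> {}"
    and \<eta>x: "0 \<le> \<eta> \<bullet> x" and \<kappa>: "\<And>\<theta>. \<theta> \<in> \<Theta> \<Longrightarrow> \<eta> \<bullet> x + max 0 (\<theta> \<bullet> x - c * ln (mgf \<theta>)) \<le> \<kappa>"
    and \<delta>: "\<delta> > 0"
  shows "eventually (\<lambda>b. ennreal (exp (- (\<kappa> + \<delta>) * b)) \<le> second_moment M X J W P \<Theta> b) at_top"
proof -
  let ?u = "tilted_mean \<eta>"
  obtain \<rho>1 where \<rho>1: "\<rho>1 > 0" "ball x \<rho>1 \<subseteq> W j"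
    using W[of j] x(2) J(2) by (auto simp: open_contains_ball)
  have "compact ((\<lambda>t. t *\<^sub>R x) ` {0..2::real})"
    by (intro compact_continuous_image continuous_intros compact_Icc)
  moreover have "(\<lambda>t. t *\<^sub>R x) ` {0..2::real} \<inter> closure (W 0) = {}"
    using sep by auto
  ultimately obtain \<rho>2 where \<rho>2: "\<rho>2 > 0"
      "\<forall>p\<in>(\<lambda>t. t *\<^sub>R x) ` {0..2::real}. \<forall>y\<in>closure (W 0). \<rho>2 \<le> dist p y"
    using separate_compact_closed[of "(\<lambda>t. t *\<^sub>R x) ` {0..2::real}" "closure (W 0)"] by auto
  define \<rho> where "\<rho> = min \<rho>1 \<rho>2"
  have \<rho>: "\<rho> > 0" "ball x \<rho> \<subseteq> W j" "\<And>t y. 0 \<le> t \<Longrightarrow> t \<le> 2 \<Longrightarrow> y \<in> W 0 \<Longrightarrow> \<rho> \<le> dist (t *\<^sub>R x) y"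
  proof -
    show "\<rho> > 0" "ball x \<rho> \<subseteq> W j" using \<rho>1 \<rho>2(1) by (auto simp: \<rho>_def)
    show "\<rho> \<le> dist (t *\<^sub>R x) y" if "0 \<le> t" "t \<le> 2" "y \<in> W 0" for t y
    proof -
      have "t *\<^sub>R x \<in> (\<lambda>t. t *\<^sub>R x) ` {0..2::real}" "y \<in> closure (W 0)"
        using that closure_subset by auto
      then have "\<rho>2 \<le> dist (t *\<^sub>R x) y" using \<rho>2(2) by blast
      then show ?thesis by (simp add: \<rho>_def)
    qed
  qed
  obtain R where R: "R > 0" "\<And>\<theta>. \<theta> \<in> insert \<eta> \<Theta> \<Longrightarrow> norm \<theta> \<le> R"
    using finite_uniform_upper_bound[of "insert \<eta> \<Theta>" norm] \<Theta>(2) by auto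
  \<comment> \<open>The error \<open>4 * R * \<epsilon>\<close> uses up half of
    \<open>\<delta>\<close>; for large \<open>b\<close> the other half absorbs
    \<open>\<kappa> / c\<close> from rounding the time and \<open>ln 2\<close> from the mass
    1/2.\<close>
  define \<epsilon> where "\<epsilon> = min (\<rho> / 3) (\<delta> / (8 * R))"
  have \<epsilon>: "\<epsilon> > 0" "2 * \<epsilon> < \<rho>" "4 * (R * \<epsilon>) \<le> \<delta> / 2"
  proof -
    show "\<epsilon> > 0" "2 * \<epsilon> < \<rho>" using \<rho>(1) \<delta> R(1) by (auto simp: \<epsilon>_def)
    have "\<epsilon> \<le> \<delta> / (8 * R)" by (simp add: \<epsilon>_def)
    then have "\<epsilon> * (8 * R) \<le> \<delta>" using R(1) by (subst (asm) pos_le_divide_eq) auto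
    then show "4 * (R * \<epsilon>) \<le> \<delta> / 2" by (simp add: algebra_simps)
  qed
  have bound: "ennreal (exp (- (\<kappa> * (b + 1 / c)) - 4 * (R * (\<epsilon> * b))) / 2) \<le> second_moment M X J W P \<Theta> b"
    if b: "b > 0" "c * b \<ge> 1" "2 * norm ?u < b * \<rho>"
      and conc: "emeasure (P \<eta>) (\<Union>n\<in>{..nat \<lceil>c * b\<rceil>}. at_time n {y. \<epsilon> * b < norm (y - real n *\<^sub>R ?u)}) \<le> ennreal (1/2)"
    for b
  proof -
    define N where "N = nat \<lceil>c * b\<rceil>"
    define C where "C n = hit_event J W b n \<inter> at_time n (cball (real n *\<^sub>R ?u) (\<epsilon> * b))" for n
    define q where "q = exp (- (\<kappa> * (b + 1 / c)) - 4 * (R * (\<epsilon> * b)))"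
    have CF: "C n \<in> sets (natural_filtration M X n)" for n
      unfolding C_def using hit_event_F[OF J(1) b(1) W] by (intro sets.Int at_time_F) auto
    have CM: "C n \<in> sets M" for n using CF by (rule F_subset)
    have N: "real N \<le> c * b + 1" using b(1) c by (simp add: N_def)
    have "\<exists>k\<ge>0. (\<forall>\<omega>\<in>C n. k \<le> (sampling_estimator M X J W \<Theta> b \<omega>)\<^sup>2) \<and>
        ennreal q * emeasure (P \<eta>) (C n) \<le> ennreal k * emeasure (mixture M P \<Theta>) (C n)" if n: "n \<le> N" for n
    proof -
      have le: "n * (\<eta> \<bullet> ?u) + n * (\<theta> \<bullet> ?u - ln (mgf \<theta>)) \<le> \<kappa> * (b + 1 / c)" if \<theta>: "\<theta> \<in> \<Theta>" for \<theta>
      proof -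
        \<comment> \<open>In this time scale the exponent is linear in \<open>s\<close>, which
          ranges from 0 to \<open>b + 1 / c\<close> because the hit may come early. The positive
          part and \<open>0 \<le> \<eta> \<bullet> x\<close> make the bound increasing in
          \<open>s\<close>, so the last time is the worst case.\<close>
        define s where "s = n / c"
        have "s \<le> (c * b + 1) / c" unfolding s_def using c n N by (intro divide_right_mono) auto
        also have "\<dots> = b + 1 / c" using c by (simp add: add_divide_distrib)
        finally have s: "0 \<le> s" "s \<le> b + 1 / c" "real n = s * c"
          using c by (auto simp: s_def)
        have "n * (\<eta> \<bullet> ?u) + n * (\<theta> \<bullet> ?u - ln (mgf \<theta>)) = s * (\<eta> \<bullet> x + (\<theta> \<bullet> x - c * ln (mgf \<theta>)))"
          by (simp add: x s(3) algebra_simps)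
        also have "\<dots> \<le> s * (\<eta> \<bullet> x + max 0 (\<theta> \<bullet> x - c * ln (mgf \<theta>)))"
          using s(1) by (intro mult_left_mono) auto
        also have "\<dots> \<le> (b + 1 / c) * \<kappa>"
          using s(1,2) \<kappa>[OF \<theta>] \<eta>x b c by (intro mult_mono) auto
        finally show ?thesis by (simp add: mult.commute)
      qed
      have close: "norm (walk X n \<omega> - real n *\<^sub>R ?u) \<le> \<epsilon> * b" if "\<omega> \<in> C n" for \<omega>
        using that by (simp add: C_def at_time_def dist_norm norm_minus_commute)
      obtain k where "k \<ge> 0" "\<And>\<omega>. \<omega> \<in> C n \<Longrightarrow> k \<le> (sampling_estimator M X J W \<Theta> b \<omega>)\<^sup>2"
        "ennreal q * emeasure (P \<eta>) (C n) \<le> ennreal k * emeasure (mixture M P \<Theta>) (C n)"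
        using near_line_contribution[OF \<eta> \<Theta> R(2) R(2) CF _ close le, of J W b] unfolding q_def C_def by blast
      then show ?thesis by blast
    qed
    then obtain k where k: "\<And>n. n \<le> N \<Longrightarrow> k n \<ge> 0"
      "\<And>n \<omega>. n \<le> N \<Longrightarrow> \<omega> \<in> C n \<Longrightarrow> k n \<le> (sampling_estimator M X J W \<Theta> b \<omega>)\<^sup>2"
      "\<And>n. n \<le> N \<Longrightarrow> ennreal q * emeasure (P \<eta>) (C n) \<le> ennreal (k n) * emeasure (mixture M P \<Theta>) (C n)"
      by metis
    have smix: "sets (mixture M P \<Theta>) = sets M"
      by (rule sets_mixture) (use \<Theta>(1) sets_P in blast)
    interpret P\<eta>: prob_space "P \<eta>" by (rule prob_space_P[OF \<eta>(1)])
    let ?bad = "\<Union>n\<in>{..N}. at_time n {y. \<epsilon> * b < norm (y - real n *\<^sub>R ?u)}"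
    have badM: "?bad \<in> sets M"
      by (intro sets.finite_UN F_subset[OF at_time_F[OF order_refl]]) auto
    have spc: "space (P \<eta>) = space M" using sets_eq_imp_space_eq[OF sets_P[OF \<eta>(1)]] .
    have "space M - ?bad \<subseteq> (\<Union>n\<in>{..N}. C n)"
    proof
      fix \<omega> assume w: "\<omega> \<in> space M - ?bad"
      then have path: "norm (walk X n \<omega> - real n *\<^sub>R ?u) \<le> \<epsilon> * b" if "n \<le> N" for n
        using that by (auto simp: at_time_def not_less)
      then obtain n where n: "n \<le> N" "\<omega> \<in> hit_event J W b n"
        using near_line_path_hits[of x c ?u b \<rho> \<epsilon> J j W \<omega>] x c b \<epsilon>(2) J \<rho>(2,3) w unfolding N_def by blast
      then show "\<omega> \<in> (\<Union>n\<in>{..N}. C n)"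
        using path[OF n(1)] w by (auto simp: C_def at_time_def dist_norm norm_minus_commute)
    qed
    then have "emeasure (P \<eta>) (space M - ?bad) \<le> emeasure (P \<eta>) (\<Union>n\<in>{..N}. C n)"
      using CM sets_P[OF \<eta>(1)] by (intro emeasure_mono sets.finite_UN) auto
    also have "\<dots> \<le> (\<Sum>n\<le>N. emeasure (P \<eta>) (C n))"
      using CM sets_P[OF \<eta>(1)] by (intro emeasure_subadditive_finite) auto
    finally have mass: "emeasure (P \<eta>) (space M - ?bad) \<le> (\<Sum>n\<le>N. emeasure (P \<eta>) (C n))" .
    have half: "ennreal (1 / 2) \<le> emeasure (P \<eta>) (space M - ?bad)"
    proof -
      have bp: "?bad \<in> sets (P \<eta>)" using badM sets_P[OF \<eta>(1)] by simp
      have "P\<eta>.prob ?bad \<le> 1 / 2"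
        using conc unfolding N_def P\<eta>.emeasure_eq_measure by (subst (asm) ennreal_le_iff) auto
      then have "1 / 2 \<le> P\<eta>.prob (space M - ?bad)"
        using P\<eta>.prob_compl[OF bp] by (simp add: spc)
      then show ?thesis unfolding P\<eta>.emeasure_eq_measure by (rule ennreal_leI)
    qed
    have "ennreal (q / 2) = ennreal q * ennreal (1 / 2)"
      using ennreal_mult[of q "1 / 2"] by (simp add: q_def del: ennreal_divide_numeral)
    also have "\<dots> \<le> ennreal q * (\<Sum>n\<le>N. emeasure (P \<eta>) (C n))"
      by (intro mult_left_mono order_trans[OF half mass]) simp
    also have "\<dots> = (\<Sum>n\<le>N. ennreal q * emeasure (P \<eta>) (C n))"
      by (rule sum_distrib_left)
    also have "\<dots> \<le> (\<Sum>n\<le>N. ennreal (k n) * emeasure (mixture M P \<Theta>) (C n))"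
      by (intro sum_mono k(3)) auto
    also have "\<dots> = (\<integral>\<^sup>+\<omega>. (\<Sum>n\<le>N. ennreal (k n) * indicator (C n) \<omega>) \<partial>mixture M P \<Theta>)"
      using CM by (subst nn_integral_sum) (auto simp: smix nn_integral_cmult_indicator cong: measurable_cong_sets)
    also have "\<dots> \<le> second_moment M X J W P \<Theta> b"
      unfolding second_moment_def
    proof (intro nn_integral_mono)
      fix \<omega>
      show "(\<Sum>n\<le>N. ennreal (k n) * indicator (C n) \<omega>) \<le> ennreal ((sampling_estimator M X J W \<Theta> b \<omega>)\<^sup>2)"
      proof (cases "\<exists>n\<le>N. \<omega> \<in> C n")
        case True
        then obtain m where m: "m \<le> N" "\<omega> \<in> C m" by blast
        have "\<omega> \<in> C n \<longleftrightarrow> n = m" for n using m(2) by (auto simp: C_def hit_event_def)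
        then have "(\<Sum>n\<le>N. ennreal (k n) * indicator (C n) \<omega>) = (\<Sum>n\<le>N. if n = m then ennreal (k n) else 0)"
          by (intro sum.cong) (auto simp: indicator_def)
        also have "\<dots> = ennreal (k m)" using m(1) by simp
        finally show ?thesis using k(2)[OF m] by (simp add: ennreal_leI)
      next
        case False
        then have "(\<Sum>n\<le>N. ennreal (k n) * indicator (C n) \<omega>) = 0"
          by (intro sum.neutral) (auto simp: indicator_def)
        then show ?thesis by simp
      qed
    qed
    finally show ?thesis by (simp add: q_def)
  qed
  have "eventually (\<lambda>b. emeasure (P \<eta>) (\<Union>n\<in>{..nat \<lceil>c * b\<rceil>}. at_time n {y. \<epsilon> * b < norm (y - real n *\<^sub>R ?u)})
      \<le> ennreal (1/2)) at_top"
    by (rule walk_concentration[OF \<eta> \<epsilon>(1) c])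
  moreover have "eventually (\<lambda>b. max 1 (max (1 / c) (max (2 * norm ?u / \<rho>) ((\<kappa> / c + ln 2) / (\<delta> / 2)))) < b) at_top"
    by (rule eventually_gt_at_top)
  ultimately show ?thesis
  proof eventually_elim
    case (elim b)
    then have b: "b > 0" "1 / c < b" "2 * norm ?u / \<rho> < b" "(\<kappa> / c + ln 2) / (\<delta> / 2) < b" by auto
    then have b': "c * b \<ge> 1" "2 * norm ?u < b * \<rho>" "\<kappa> / c + ln 2 < b * (\<delta> / 2)"
      using c \<rho>(1) \<delta> by (simp_all add: pos_divide_less_eq mult.commute)
    have "4 * (R * \<epsilon>) * b \<le> \<delta> / 2 * b" using \<epsilon>(3) b(1) by (intro mult_right_mono) auto
    moreover have "- (\<kappa> + \<delta>) * b = - (\<kappa> * b) - \<delta> / 2 * b - b * (\<delta> / 2)"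
      "\<kappa> * (b + 1 / c) = \<kappa> * b + \<kappa> / c" "4 * (R * (\<epsilon> * b)) = 4 * (R * \<epsilon>) * b"
      by (simp_all add: algebra_simps)
    ultimately have "- (\<kappa> + \<delta>) * b \<le> - (\<kappa> * (b + 1 / c)) - 4 * (R * (\<epsilon> * b)) - ln 2"
      using b'(3) by linarith
    then have "exp (- (\<kappa> + \<delta>) * b) \<le> exp (- (\<kappa> * (b + 1 / c)) - 4 * (R * (\<epsilon> * b)) - ln 2)"
      by simp
    also have "\<dots> = exp (- (\<kappa> * (b + 1 / c)) - 4 * (R * (\<epsilon> * b))) / 2" by (simp add: exp_diff)
    finally have "ennreal (exp (- (\<kappa> + \<delta>) * b)) \<le> ennreal (exp (- (\<kappa> * (b + 1 / c)) - 4 * (R * (\<epsilon> * b))) / 2)"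
      by (rule ennreal_leI)
    also have "\<dots> \<le> second_moment M X J W P \<Theta> b"
      by (rule bound[OF b(1) b'(1,2) elim(1)])
    finally show ?case .
  qed
qed

end

section \<open>Inefficiency\<close>

lemma elog_mono: "x \<le> y \<Longrightarrow> elog x \<le> elog y"
  by (cases x; cases y) (auto simp: elog_def top_unique ennreal_eq_0_iff)

lemma elog_ennreal: "x > 0 \<Longrightarrow> elog (ennreal x) = ereal (ln x)"
  by (simp add: elog_def)

lemma elog_less_infinity_iff: "elog x < \<infinity> \<longleftrightarrow> x < \<infinity>"
  by (auto simp: elog_def less_top)

text \<open>The infinite cases are harmless: with a finite denominator an infinite second moment
  gives quotient \<open>-\<infinity>\<close>, and hitting probability 0 gives denominator
  \<open>-\<infinity>\<close> and quotient 0.\<close>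

lemma ereal_divide_neg_le:
  fixes a d :: ereal
  assumes "ereal (- A) \<le> a" "A \<ge> 0" "d \<le> ereal (- D)" "D > 0"
  shows "a / d \<le> ereal (A / D)"
proof (cases d)
  case (real d')
  then have d': "D \<le> - d'" using assms(3) by simp
  show ?thesis
  proof (cases a)
    case (real a')
    then have "- a' \<le> A" using assms(1) by simp
    then have "- a' / - d' \<le> A / D"
      using d' assms(2,4) by (intro frac_le) auto
    then show ?thesis using real \<open>d = ereal d'\<close> d' assms(4) by simp
  next
    case PInf
    then show ?thesis using \<open>d = ereal d'\<close> d' assms(4) by (simp add: divide_ereal_def)
  qed (use assms(1) in auto)
next
  case MInf
  then show ?thesis using assms(2,4) by (simp add: divide_ereal_def)
qed (use assms(3) in auto)

lemma subset_pos_cone: "A \<subseteq> pos_cone A"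
  unfolding pos_cone_def by (force intro: exI[of _ 1])

text \<open>Excludes a zero mean, for which the cone of \<open>cond_C1\<close> would be the whole
  space and every target empty.\<close>

lemma pos_cone_ball_0:
  assumes "\<delta> > 0"
  shows "pos_cone (ball (0 :: 'v::real_normed_vector) \<delta>) = UNIV"
proof -
  have "x \<in> pos_cone (ball 0 \<delta>)" for x :: 'v
  proof -
    define c where "c = (norm x + 1) / \<delta>"
    have c: "c > 0" using assms by (simp add: c_def add_nonneg_pos)
    have "norm x < c * \<delta>" using assms by (simp add: c_def)
    then have "(1 / c) *\<^sub>R x \<in> ball 0 \<delta>" using c by (simp add: pos_divide_less_eq mult.commute)
    moreover have "x = c *\<^sub>R ((1 / c) *\<^sub>R x)" using c by simp
    ultimately show ?thesis unfolding pos_cone_def using c by blast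
  qed
  then show ?thesis by blast
qed

text \<open>Stated outside \<open>tilted_walk\<close> because the openness assumed there is obtained
  from \<open>cond_C2\<close>, which speaks of \<open>edom\<close>.\<close>

lemma edom_cgf:
  fixes X :: "nat \<Rightarrow> 'a \<Rightarrow> real^'d"
  assumes "random_vector M (X 1)"
  shows "edom (cgf M X) = random_vector.mgf_dom M (X 1)"
  unfolding edom_def cgf_def elog_less_infinity_iff
  using random_vector.mgf_dom_iff[OF assms] by blast

section \<open>Translation of the geometric conditions and conclusion\<close>

context tilted_walk
begin

lemma tilted_mean_0: "tilted_mean 0 = (\<integral>\<omega>. X 1 \<omega> \<partial>M)"
  unfolding X_1 by (simp add: tilted_mean_def)

lemma cgf_eq_0:
  assumes "cgf M X \<theta> = 0"
  shows "\<theta> \<in> mgf_dom" "mgf \<theta> = 1"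
proof -
  show \<theta>: "\<theta> \<in> mgf_dom" using assms cgf_infinite by fastforce
  show "mgf \<theta> = 1" using assms mgf_pos[OF \<theta>] by (simp add: cgf_eq[OF \<theta>] zero_ereal_def)
qed

lemma support_rate_le_iff: "support_rate M X x \<le> ereal B \<longleftrightarrow> (\<forall>\<theta>\<in>mgf_sublevel. \<theta> \<bullet> x \<le> B)"
  unfolding support_rate_def cgf_le_0_iff by (simp add: SUP_le_iff)

text \<open>Where \<Lambda>(\<theta>) \<le> 0, the value \<open>\<theta> \<bullet> z\<close> is at
  most \<open>\<theta> \<bullet> z\<close> minus \<Lambda>(\<theta>), hence at most
  \<open>rate M X z\<close>; homogeneity passes from the domain to its cone.\<close>

lemma support_finite_on_rate_cone:
  assumes "y \<in> pos_cone (edom (rate M X))"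
  shows "\<exists>B. \<forall>\<theta>\<in>mgf_sublevel. \<theta> \<bullet> y \<le> B"
proof -
  obtain c z where c: "c > 0" "y = c *\<^sub>R z" and z: "rate M X z < \<infinity>"
    using assms unfolding pos_cone_def edom_def by blast
  have le: "ereal (\<theta> \<bullet> z) - cgf M X \<theta> \<le> rate M X z" for \<theta>
    unfolding rate_def by (rule SUP_upper) simp
  have "0 \<le> rate M X z"
    using le[of 0] by (simp add: cgf_eq[OF zero_in_mgf_dom] mgf_zero zero_ereal_def)
  with z obtain B where B: "rate M X z = ereal B" by (cases "rate M X z") auto
  have "\<theta> \<bullet> y \<le> c * B" if \<theta>: "\<theta> \<in> mgf_sublevel" for \<theta>
  proof -
    have "\<theta> \<in> mgf_dom" "ln (mgf \<theta>) \<le> 0" using \<theta> mgf_pos[of \<theta>] by (auto simp: mgf_sublevel_def)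
    then have "\<theta> \<bullet> z \<le> B" using le[of \<theta>] B by (simp add: cgf_eq)
    then show ?thesis using c by simp
  qed
  then show ?thesis by blast
qed

lemma sampling_inefficiency:
  assumes J: "J \<ge> 1" and W: "\<And>j. j \<in> {1..J} \<Longrightarrow> open (W j) \<and> convex (W j)" and W0: "open (W 0)"
    and C1: "cond_C1 M X J W" and C2: "cond_C2 M X J W" and C3: "cond_C3 J W" and C4: "cond_C4 M X J W"
    and \<beta>: "\<And>j. j \<in> {1..J} \<Longrightarrow> is_optimal_tilting M X (W j) (\<beta> j)"
    and \<Theta>: "\<Theta> \<subseteq> mgf_dom" "finite \<Theta>" "\<Theta> \<noteq> {}"
    and j: "j \<in> {1..J}" "set_rate M X (W j) = min_rate M X J W" "\<beta> j \<notin> \<Theta>"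
    and distinct: "\<And>\<theta>. \<theta> \<in> \<Theta> \<Longrightarrow> same_tilting M X \<theta> (\<beta> j) \<Longrightarrow> \<theta> = \<beta> j"
  shows "\<not> asymptotically_efficient M X J W P \<Theta> \<and>
    Liminf at_top (\<lambda>b::real. ereal (1 / b) * elog (second_moment M X J W P \<Theta> b))
      > - (2 * min_rate M X J W)"
proof -
  obtain \<delta>1 where \<delta>1: "\<delta>1 > 0" "\<And>i. i \<in> {1..J} \<Longrightarrow> pos_cone (ball (tilted_mean 0) \<delta>1) \<inter> W i = {}"
    using C1 unfolding cond_C1_def tilted_mean_0 by blast
  obtain \<delta>2 where \<delta>2: "\<delta>2 > 0" "\<And>i. i \<in> {0..J} \<Longrightarrow> ball 0 \<delta>2 \<inter> W i = {}"
    using C3 unfolding cond_C3_def by blast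
  have far: "\<delta>2 \<le> norm x" if "x \<in> W i" "i \<in> {0..J}" for x i
    using \<delta>2(2)[OF that(2)] that(1) by (auto simp: disjoint_iff not_less)
  have C2': "interior (pos_cone (edom (rate M X))) \<inter> W i \<noteq> {}" if "i \<in> {1..J}" for i
    using C2 that unfolding cond_C2_def by blast
  have mean: "tilted_mean 0 \<noteq> 0"
  proof
    assume "tilted_mean 0 = 0"
    then have "W j = {}" using \<delta>1 j(1) pos_cone_ball_0[OF \<delta>1(1), where 'v = "real^'d"] by auto
    with C2'[OF j(1)] show False by simp
  qed
  obtain r0 where r0: "r0 > 0" "\<And>x. \<delta>2 \<le> norm x \<Longrightarrow> x \<notin> pos_cone (ball (tilted_mean 0) \<delta>1) \<Longrightarrow>
      \<exists>\<theta>\<in>mgf_sublevel. r0 \<le> \<theta> \<bullet> x"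
    using support_positive_off_mean_cone[OF mean \<delta>2(1) \<delta>1(1)] by blast
  obtain x0 where x0: "x0 \<in> interior (pos_cone (edom (rate M X)))" "x0 \<in> W j"
    using C2'[OF j(1)] by blast
  obtain e where e: "e > 0" "ball x0 e \<subseteq> pos_cone (edom (rate M X))"
    using x0(1) mem_interior by blast
  define \<rho> where "\<rho> = set_rate M X (W j)"
  have "ereal r0 \<le> \<rho>"
    unfolding \<rho>_def set_rate_def
  proof (rule INF_greatest)
    fix x assume x: "x \<in> W j"
    then have "x \<notin> pos_cone (ball (tilted_mean 0) \<delta>1)" using \<delta>1(2)[OF j(1)] by blast
    then obtain \<theta> where \<theta>: "\<theta> \<in> mgf_sublevel" "r0 \<le> \<theta> \<bullet> x"
      using r0(2) far[OF x] j(1) by auto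
    have "ereal (\<theta> \<bullet> x) \<le> support_rate M X x"
      unfolding support_rate_def cgf_le_0_iff using \<theta>(1) by (intro SUP_upper) simp
    with \<theta>(2) show "ereal r0 \<le> support_rate M X x" by (meson ereal_less_eq(3) order_trans)
  qed
  moreover have "\<rho> < \<infinity>"
  proof -
    obtain B where "\<forall>\<theta>\<in>mgf_sublevel. \<theta> \<bullet> x0 \<le> B"
      using support_finite_on_rate_cone subsetD[OF interior_subset x0(1)] by blast
    then have "support_rate M X x0 \<le> ereal B" by (simp add: support_rate_le_iff)
    then have "\<rho> \<le> ereal B" unfolding \<rho>_def set_rate_def using x0(2) by (rule INF_lower2[rotated])
    then show ?thesis by (rule le_less_trans) simp
  qed
  ultimately obtain r where r: "\<rho> = ereal r" "r > 0" using r0(1) by (cases \<rho>) auto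
  have min_r: "min_rate M X J W = ereal r" using j(2) r(1) by (simp add: \<rho>_def)
  have \<beta>': "\<beta> i \<in> mgf_dom \<and> mgf (\<beta> i) = 1" if "i \<in> {1..J}" for i
    using \<beta>[OF that] cgf_eq_0[of "\<beta> i"] by (simp add: is_optimal_tilting_def)
  have \<beta>_ge: "r \<le> \<beta> i \<bullet> x" if i: "i \<in> {1..J}" and x: "x \<in> W i" for i x
  proof -
    have "ereal r \<le> set_rate M X (W i)"
      unfolding min_r[symmetric] min_rate_def using i by (intro Min_le) auto
    also have "\<dots> \<le> ereal (\<beta> i \<bullet> x)" using \<beta>[OF i] x by (auto simp: is_optimal_tilting_def)
    finally show ?thesis by simp
  qed
  have near: "\<exists>x\<in>W j. \<forall>\<theta>\<in>mgf_sublevel. \<theta> \<bullet> x \<le> r + \<epsilon>" if "\<epsilon> > 0" for \<epsilon>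
  proof -
    have "set_rate M X (W j) < ereal (r + \<epsilon>)" using r that by (simp add: \<rho>_def)
    then obtain x where "x \<in> W j" "support_rate M X x < ereal (r + \<epsilon>)"
      unfolding set_rate_def by (auto simp: INF_less_iff)
    then show ?thesis using support_rate_le_iff less_imp_le by blast
  qed
  \<comment> \<open>Here the absence of \<open>\<beta> j\<close> from \<open>\<Theta>\<close>
    enters: it makes \<Lambda> strictly convex between each \<open>\<theta>\<close> and
    \<open>\<beta> j\<close>.\<close>
  have separated: "\<not> (AE \<omega> in M. (\<theta> - \<beta> j) \<bullet> Y \<omega> = c)" if "\<theta> \<in> \<Theta>" for \<theta> c
    using distinct[OF that] that j(3) unfolding same_tilting_def X_1 by blast
  obtain \<eta> c x where \<eta>: "\<eta> \<in> mgf_dom" "mgf \<eta> = 1" and c: "c > 0" and x: "x = c *\<^sub>R tilted_mean \<eta>" "x \<in> W j"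
    and \<eta>x: "0 \<le> \<eta> \<bullet> x"
    and cost: "\<And>\<theta>. \<theta> \<in> \<Theta> \<Longrightarrow> \<eta> \<bullet> x + max 0 (\<theta> \<bullet> x - c * ln (mgf \<theta>)) < 2 * r"
  proof (rule cost_below_twice_rate[of "W j" \<delta>2 "\<beta> j" r x0 e \<Theta>])
    show "convex (W j)" using W j(1) by blast
    show "\<delta>2 \<le> norm x" if "x \<in> W j" for x using far[OF that] j(1) by simp
    show "\<exists>B. \<forall>\<theta>\<in>mgf_sublevel. \<theta> \<bullet> y \<le> B" if "y \<in> ball x0 e" for y
      using support_finite_on_rate_cone e(2) that by blast
  qed (use \<delta>2(1) \<beta>'[OF j(1)] \<beta>_ge[OF j(1)] r(2) near x0(2) e(1) mean \<Theta> separated in auto)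
  have "x \<noteq> 0" using far[OF x(2)] \<delta>2(1) j(1) by auto
  \<comment> \<open>For \<open>t > 0\<close> the point lies in the cone of \<open>W j\<close>, whose
    closure meets that of the cone of \<open>W 0\<close> only at 0; the ball of
    \<open>cond_C3\<close> settles \<open>t = 0\<close>.\<close>
  have sep: "t *\<^sub>R x \<notin> closure (W 0)" if t: "0 \<le> t" "t \<le> 2" for t
  proof
    assume tx: "t *\<^sub>R x \<in> closure (W 0)"
    then have ne: "W 0 \<noteq> {}" by auto
    have "ball 0 \<delta>2 \<inter> closure (W 0) = {}"
      using open_Int_closure_eq_empty[of "ball 0 \<delta>2" "W 0"] \<delta>2(2) by simp
    then have "0 \<notin> closure (W 0)" using \<delta>2(1) centre_in_ball by blast
    with tx t have "t > 0" by (cases "t = 0") auto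
    then have "t *\<^sub>R x \<in> pos_cone (W j)" unfolding pos_cone_def using x(2) by blast
    then have "t *\<^sub>R x \<in> closure (pos_cone (W j))" using closure_subset by blast
    moreover have "t *\<^sub>R x \<in> closure (pos_cone (W 0))" using tx closure_mono[OF subset_pos_cone, of "W 0"] by (rule subsetD[rotated])
    moreover have "closure (pos_cone (W j)) \<inter> closure (pos_cone (W 0)) = {0}"
    proof -
      have "W j \<noteq> {}" "j \<in> {0..J}" "0 \<in> {0..J}" "j \<noteq> 0" using x(2) j(1) by auto
      with C4 ne show ?thesis unfolding cond_C4_def by blast
    qed
    ultimately have "t *\<^sub>R x = 0" by blast
    with \<open>t > 0\<close> \<open>x \<noteq> 0\<close> show False by simp
  qed
  define \<kappa> where "\<kappa> = Max ((\<lambda>\<theta>. \<eta> \<bullet> x + max 0 (\<theta> \<bullet> x - c * ln (mgf \<theta>))) ` \<Theta>)"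
  have \<kappa>_ge: "\<eta> \<bullet> x + max 0 (\<theta> \<bullet> x - c * ln (mgf \<theta>)) \<le> \<kappa>" if "\<theta> \<in> \<Theta>" for \<theta>
    unfolding \<kappa>_def using \<Theta>(2) that by (intro Max_ge) auto
  have \<kappa>_less: "\<kappa> < 2 * r" unfolding \<kappa>_def using \<Theta> cost by (subst Max_less_iff) auto
  have "\<kappa> \<ge> 0" using \<kappa>_ge \<eta>x \<Theta>(3) by (metis add_nonneg_nonneg all_not_in_conv max.cobounded1 order_trans)
  \<comment> \<open>The midpoint of \<open>\<kappa>\<close> and \<open>2 * r\<close>, written as
    \<open>\<kappa>\<close> plus the loss allowed in
    \<open>second_moment_lower_bound\<close>.\<close>
  define q where "q = \<kappa> + (r - \<kappa> / 2)"
  have q: "0 \<le> q" "q < 2 * r" using \<open>\<kappa> \<ge> 0\<close> \<kappa>_less by (auto simp: q_def)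
  have "eventually (\<lambda>b. ennreal (exp (- q * b)) \<le> second_moment M X J W P \<Theta> b) at_top"
    unfolding q_def
  proof (rule second_moment_lower_bound[OF J j(1) _ \<eta> c x sep \<Theta> \<eta>x \<kappa>_ge])
    show "open (W i)" if "i \<le> J" for i
      using W[of i] W0 that by (cases "i = 0") auto
    show "0 < r - \<kappa> / 2" using \<kappa>_less by linarith
  qed
  then have lower: "eventually (\<lambda>b. ereal (- (q * b)) \<le> elog (second_moment M X J W P \<Theta> b)) at_top"
  proof eventually_elim
    case (elim b)
    from elog_mono[OF this] show ?case by (simp add: elog_ennreal)
  qed
  have "ereal (- q) \<le> Liminf at_top (\<lambda>b::real. ereal (1 / b) * elog (second_moment M X J W P \<Theta> b))"
  proof (rule Liminf_bounded)
    show "eventually (\<lambda>b::real. ereal (- q) \<le> ereal (1 / b) * elog (second_moment M X J W P \<Theta> b)) at_top"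
      using lower eventually_gt_at_top[of 0]
    proof eventually_elim
      case (elim b)
      have "ereal (- q) = ereal (1 / b) * ereal (- (q * b))" using elim(2) by simp
      also have "\<dots> \<le> ereal (1 / b) * elog (second_moment M X J W P \<Theta> b)"
        using elim by (intro ereal_mult_left_mono) auto
      finally show ?case .
    qed
  qed
  moreover have "- (2 * min_rate M X J W) < ereal (- q)" using q by (simp add: min_r)
  ultimately have liminf: "- (2 * min_rate M X J W)
      < Liminf at_top (\<lambda>b::real. ereal (1 / b) * elog (second_moment M X J W P \<Theta> b))"
    by (rule less_le_trans[rotated])
  \<comment> \<open>The bounds on numerator and denominator give a quotient tending to
    \<open>q / (2 * r) < 1\<close>. The midpoint to 1 leaves room for the factor \<open>J\<close> in
    the hitting probability.\<close>
  define L where "L = (q / (2 * r) + 1) / 2"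
  have L: "L < 1" "0 < L" "q = 4 * r * L - 2 * r" using q r(2) by (auto simp: L_def field_simps)
  have L1: "ereal L < 1" using L(1) unfolding one_ereal_def less_ereal.simps .
  have "\<not> asymptotically_efficient M X J W P \<Theta>"
  proof
    assume "asymptotically_efficient M X J W P \<Theta>"
    then have "eventually (\<lambda>b. ereal L < elog (second_moment M X J W P \<Theta> b) /
         (2 * elog (emeasure M {\<omega> \<in> space M. first_target_time X J W b \<omega> < hit_time X (W 0) b \<omega>}))) at_top"
      unfolding asymptotically_efficient_def using L1 by (rule order_tendstoD(1))
    \<comment> \<open>The first threshold makes \<open>D = 2 * (r * b - ln J)\<close> positive; the
      second is \<open>q * b < L * D\<close> solved for \<open>b\<close>.\<close>
    moreover have "eventually (\<lambda>b. max 0 (max ((ln J + 1) / r) (2 * L * ln J / (2 * r * (1 - L)))) < b) at_top"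
      by (rule eventually_gt_at_top)
    ultimately have "eventually (\<lambda>b::real. False) at_top"
      using lower
    proof eventually_elim
      case (elim b)
      let ?p = "emeasure M {\<omega> \<in> space M. first_target_time X J W b \<omega> < hit_time X (W 0) b \<omega>}"
      have b: "b > 0" "ln J + 1 < b * r" "2 * L * ln J < b * (2 * r * (1 - L))"
        using elim(2) r(2) L by (simp_all add: pos_divide_less_eq)
      define D where "D = 2 * (r * b - ln J)"
      have D: "D > 0" using b(2) by (simp add: D_def mult.commute)
      have "elog ?p \<le> elog (ennreal (J * exp (- (r * b))))"
        using W J by (intro elog_mono hit_probability_upper_bound[OF J b(1) _ \<beta>' \<beta>_ge]) auto
      also have "\<dots> = ereal (ln J - r * b)" using J by (simp add: elog_ennreal ln_mult)
      finally have "2 * elog ?p \<le> 2 * ereal (ln J - r * b)" by (intro ereal_mult_left_mono) auto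
      also have "\<dots> = ereal (- D)" by (simp add: D_def)
      finally have "elog (second_moment M X J W P \<Theta> b) / (2 * elog ?p) \<le> ereal (q * b / D)"
        using elim(3) q(1) b(1) D by (intro ereal_divide_neg_le) auto
      also have "q * b / D \<le> L"
        using b(3) D unfolding L(3) by (simp add: pos_divide_le_eq D_def algebra_simps)
      finally show False using elim(1) by (auto simp: not_less[symmetric])
    qed
    then show False by simp
  qed
  with liminf show ?thesis by blast
qed

end

theorem theorem3p5:
  fixes M :: "'a measure"
    and X :: "nat \<Rightarrow> 'a \<Rightarrow> real^'d"
    and J :: nat
    and W :: "nat \<Rightarrow> (real^'d) set"
    and P :: "real^'d \<Rightarrow> 'a measure"
    and \<beta> :: "nat \<Rightarrow> real^'d"
    and \<Theta> :: "(real^'d) set"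
  assumes "prob_space M"
    and "iid_vectors M X"
    and "J \<ge> 1"
    and "\<forall>j\<in>{1..J}. open (W j) \<and> convex (W j)"
    and "open (W 0)"
    and "cond_C1 M X J W"
    and "cond_C2 M X J W"
    and "cond_C3 J W"
    and "cond_C4 M X J W"
    and "\<forall>j\<in>{1..J}. is_optimal_tilting M X (W j) (\<beta> j)"
    and "\<forall>\<theta>\<in>edom (cgf M X). is_tilted_measure M X \<theta> (P \<theta>)"
    and "\<Theta> \<subseteq> edom (cgf M X)"
    and "finite \<Theta>"
    and "\<Theta> \<noteq> {}"
    and "\<exists>j\<in>{j\<in>{1..J}. set_rate M X (W j) = min_rate M X J W}. \<beta> j \<notin> \<Theta>"
    and "\<forall>j\<in>{j\<in>{1..J}. set_rate M X (W j) = min_rate M X J W}. \<forall>\<theta>\<in>\<Theta>.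
           same_tilting M X \<theta> (\<beta> j) \<longrightarrow> \<theta> = \<beta> j"
  shows "\<not> asymptotically_efficient M X J W P \<Theta> \<and>
    Liminf at_top (\<lambda>b::real. ereal (1 / b) * elog (second_moment M X J W P \<Theta> b))
      > - (2 * min_rate M X J W)"
proof -
  define Y where "Y = X 1"
  interpret prob_space M by fact
  have X: "X i \<in> borel_measurable M" if "i \<ge> 1" for i
    using \<open>iid_vectors M X\<close> that by (auto simp: iid_vectors_def indep_vars_def)
  interpret random_vector M Y
    by unfold_locales (simp add: Y_def X)
  have dom: "edom (cgf M X) = mgf_dom" 
    using edom_cgf[of M X] random_vector_axioms unfolding Y_def by blast
  interpret tilted_walk M Y X P
  proof unfold_locales
    show "open mgf_dom" using \<open>cond_C2 M X J W\<close> by (simp add: cond_C2_def dom)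
    show "is_tilted_measure M X \<theta> (P \<theta>)" if "\<theta> \<in> mgf_dom" for \<theta>
      using assms(11) that dom by blast
  qed (simp_all add: Y_def X)
  obtain j where j: "j \<in> {1..J}" "set_rate M X (W j) = min_rate M X J W" "\<beta> j \<notin> \<Theta>"
    using assms(15) by blast
  show ?thesis
  proof (rule sampling_inefficiency[where j = j and \<beta> = \<beta>])
    show "\<theta> = \<beta> j" if "\<theta> \<in> \<Theta>" "same_tilting M X \<theta> (\<beta> j)" for \<theta>
      using assms(16) that j by blast
    show "\<Theta> \<subseteq> mgf_dom" using assms(12) dom by simp
  qed (use assms(3-10,13,14) j in blast)+
qed

end
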